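(* Let $\mathcal{X}$ be a separable, completely metrizable, locally convex $\mathbb{R}$-vector space and $\mathcal{X}^{+}\subseteq\mathcal{X}$ a convex cone. Assume that for every $0$-neighborhood $\mathcal{U}$ there are $A_1,A_2\in\mathcal{X}$ and a $0$-neighborhood $\tilde{\mathcal{U}}$ with $\tilde{\mathcal{U}}\subseteq[A_1,A_2]\subseteq\mathcal{U}$, and that some $0$-neighborhood in $\mathcal{X}$ satisfies the infinite-dimensionality condition. Then $\mathcal{D}^{+}$ is a dense $G_\delta$ subset of $\mathbf{CU}(\mathcal{X}^{\ast,+})$ in the weak*-Hausdorff hypertopology.
   Context: $\mathcal{X}^{\ast}$ is the topological dual with the weak* topology. A convex cone $\mathcal{X}^+$ satisfies $\lambda A\in\mathcal{X}^+$, $A+B\in\mathcal{X}^+$ for $\lambda>0$, $A,B\in\mathcal{X}^+$; $A\preceq B$ iff $B-A\in\mathcal{X}^+$; $[A_1,A_2]=\{A:A_1\preceq A\preceq A_2\}$. $\mathcal{X}^{\ast,+}=\{\sigma\in\mathcal{X}^{\ast}:\sigma(A)\ge0\ \forall A\in\mathcal{X}^+\}$. A $0$-neighborhood $\mathcal{U}$ satisfies the infinite-dimensionality condition if there is an infinite set $\{\sigma_n\}$ of linearly independent elements of $\mathcal{X}^{\ast}$ with $\sup_{A\in\mathcal{U}}|\sigma_n(A)|<\infty$ for every $n$. $\mathcal{U}^{\circ}=\{\sigma\in\mathcal{X}^{\ast}:|\sigma(A)|\le1\ \forall A\in\mathcal{U}\}$; $\mathbf{CU}_{\mathcal{U}}(\mathcal{X}^{\ast})$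 is the set of nonempty convex weak*-closed subsets of $\mathcal{U}^{\circ}$; $\mathbf{CU}(\mathcal{X}^{\ast,+})=\bigcup_{\mathcal{U}}\{U\in\mathbf{CU}_{\mathcal{U}}(\mathcal{X}^{\ast}):U\subseteq\mathcal{X}^{\ast,+}\}$ over all $0$-neighborhoods. $\mathcal{D}=\bigcup_{\mathcal{U}}\{U\in\mathbf{CU}_{\mathcal{U}}(\mathcal{X}^{\ast}):U=\overline{\mathcal{E}(U)}\}$, with $\mathcal{E}(U)$ the extreme points and weak*-closure, and $\mathcal{D}^+=\mathcal{D}\cap\mathbf{CU}(\mathcal{X}^{\ast,+})$. The weak*-Hausdorff hypertopology is generated by the extended pseudometrics $d_H^{(A)}(F,\tilde F)=\max\{\sup_{\sigma\in F}\inf_{\tilde\sigma\in\tilde F}|(\sigma-\tilde\sigma)(A)|,\ \sup_{\tilde\sigma\in\tilde F}\inf_{\sigma\in F}|(\sigma-\tilde\sigma)(A)|\}$, $A\in\mathcal{X}$. *)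

theory Defs
  imports "HOL-Analysis.Analysis"
begin

definition lc_tvs :: "'a::real_vector topology \<Rightarrow> bool" where
  "lc_tvs T \<longleftrightarrow> topspace T = UNIV
     \<and> continuous_map (prod_topology T T) T (\<lambda>(x, y). x + y)
     \<and> continuous_map (prod_topology euclideanreal T) T (\<lambda>(c, x). c *\<^sub>R x)
     \<and> (\<forall>U. openin T U \<and> 0 \<in> U \<longrightarrow> (\<exists>V. openin T V \<and> 0 \<in> V \<and> convex V \<and> V \<subseteq> U))"

definition zero_nbhd :: "'a::real_vector topology \<Rightarrow> 'a set \<Rightarrow> bool" where
  "zero_nbhd T U \<longleftrightarrow> (\<exists>V. openin T V \<and> 0 \<in> V \<and> V \<subseteq> U)"

definition cvx_cone :: "'a::real_vector set \<Rightarrow> bool" where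
  "cvx_cone P \<longleftrightarrow> (\<forall>c A. c > (0::real) \<and> A \<in> P \<longrightarrow> c *\<^sub>R A \<in> P)
                     \<and> (\<forall>A\<in>P. \<forall>B\<in>P. A + B \<in> P)"

definition cone_le :: "'a::real_vector set \<Rightarrow> 'a \<Rightarrow> 'a \<Rightarrow> bool" where
  "cone_le P A B \<longleftrightarrow> B - A \<in> P"

definition order_interval :: "'a::real_vector set \<Rightarrow> 'a \<Rightarrow> 'a \<Rightarrow> 'a set" where
  "order_interval P A1 A2 = {A. cone_le P A1 A \<and> cone_le P A A2}"

definition tdual :: "'a::real_vector topology \<Rightarrow> ('a \<Rightarrow> real) set" where
  "tdual T = {\<sigma>. linear \<sigma> \<and> continuous_map T euclideanreal \<sigma>}"

definition wstar :: "'a::real_vector topology \<Rightarrow> ('a \<Rightarrow> real) topology" where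
  "wstar T = subtopology (powertop_real UNIV) (tdual T)"

definition dual_cone :: "'a::real_vector topology \<Rightarrow> 'a set \<Rightarrow> ('a \<Rightarrow> real) set" where
  "dual_cone T P = {\<sigma> \<in> tdual T. \<forall>A\<in>P. \<sigma> A \<ge> 0}"

definition fun_lin_indep :: "('a \<Rightarrow> real) set \<Rightarrow> bool" where
  "fun_lin_indep S \<longleftrightarrow> (\<forall>F c. finite F \<and> F \<subseteq> S \<and> (\<forall>A. (\<Sum>\<sigma>\<in>F. c \<sigma> * \<sigma> A) = 0)
                          \<longrightarrow> (\<forall>\<sigma>\<in>F. c \<sigma> = 0))"

definition infinite_dim_cond :: "'a::real_vector topology \<Rightarrow> 'a set \<Rightarrow> bool" where
  "infinite_dim_cond T U \<longleftrightarrow> (\<exists>S. S \<subseteq> tdual T \<and> infinite S \<and> fun_lin_indep S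
      \<and> (\<forall>\<sigma>\<in>S. \<exists>M. \<forall>A\<in>U. \<bar>\<sigma> A\<bar> \<le> M))"

definition polar :: "'a::real_vector topology \<Rightarrow> 'a set \<Rightarrow> ('a \<Rightarrow> real) set" where
  "polar T U = {\<sigma> \<in> tdual T. \<forall>A\<in>U. \<bar>\<sigma> A\<bar> \<le> 1}"

definition fconvex :: "('a \<Rightarrow> real) set \<Rightarrow> bool" where
  "fconvex F \<longleftrightarrow> (\<forall>\<sigma>\<in>F. \<forall>\<tau>\<in>F. \<forall>t::real. 0 \<le> t \<and> t \<le> 1
                    \<longrightarrow> (\<lambda>A. t * \<sigma> A + (1 - t) * \<tau> A) \<in> F)"

definition fextreme_points :: "('a \<Rightarrow> real) set \<Rightarrow> ('a \<Rightarrow> real) set" where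
  "fextreme_points F = {\<sigma> \<in> F. \<forall>\<sigma>1\<in>F. \<forall>\<sigma>2\<in>F. \<forall>t::real. 0 < t \<and> t < 1
        \<and> \<sigma> = (\<lambda>A. t * \<sigma>1 A + (1 - t) * \<sigma>2 A) \<longrightarrow> \<sigma>1 = \<sigma>2}"

definition CU_U :: "'a::real_vector topology \<Rightarrow> 'a set \<Rightarrow> ('a \<Rightarrow> real) set set" where
  "CU_U T U = {F. F \<noteq> {} \<and> fconvex F \<and> closedin (wstar T) F \<and> F \<subseteq> polar T U}"

definition CU_plus :: "'a::real_vector topology \<Rightarrow> 'a set \<Rightarrow> ('a \<Rightarrow> real) set set" where
  "CU_plus T P = {F. \<exists>U. zero_nbhd T U \<and> F \<in> CU_U T U \<and> F \<subseteq> dual_cone T P}"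

definition D_set :: "'a::real_vector topology \<Rightarrow> ('a \<Rightarrow> real) set set" where
  "D_set T = {F. \<exists>U. zero_nbhd T U \<and> F \<in> CU_U T U
                   \<and> F = (wstar T) closure_of (fextreme_points F)}"

definition D_plus :: "'a::real_vector topology \<Rightarrow> 'a set \<Rightarrow> ('a \<Rightarrow> real) set set" where
  "D_plus T P = D_set T \<inter> CU_plus T P"

definition dH :: "'a \<Rightarrow> ('a \<Rightarrow> real) set \<Rightarrow> ('a \<Rightarrow> real) set \<Rightarrow> ereal" where
  "dH A F G = max (SUP \<sigma>\<in>F. INF \<tau>\<in>G. ereal \<bar>\<sigma> A - \<tau> A\<bar>)
                  (SUP \<tau>\<in>G. INF \<sigma>\<in>F. ereal \<bar>\<sigma> A - \<tau> A\<bar>)"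

definition wstar_hausdorff :: "('a \<Rightarrow> real) set topology" where
  "wstar_hausdorff = topology_generated_by
     {{G. dH A F G < ereal \<epsilon>} | A F \<epsilon>. \<epsilon> > 0}"

end

(* The interval hypothesis makes the upper endpoint u of a suitable order interval an order unit whose
   intervals [-tu, tu] form a base of 0-neighborhoods. Hence positive functionals are automatically
   continuous, a set of them is equicontinuous iff it is bounded at u, and members of CU_plus are
   compact. By Hahn-Banach, F |-> support function of F is a homeomorphism from CU_plus onto the
   sublinear functionals h with h(-p) <= 0 on the cone. These form a closed set of functions, locally
   compact because h(u) controls h, so CU_plus is a Baire space.

   Along a dense sequence in the space, let B_k(F) be the compact set of midpoints of segments in F
   of size at least 1/(k+1). The extreme points of F are the complement of the union of the B_k(F), and
   by Baire's theorem inside F they are dense iff each complement of B_k(F) is. This is a countable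
   family of open conditions on F, and each is dense: F is approximated by a simplex,
   built one vertex at a time by moving the new vertex off the previous face with a positive functional
   that does not vanish on the common kernel of the functionals used so far. *)

theory Submission
  imports Defs
begin

section \<open>Hahn--Banach extension\<close>

text \<open>The hypertopology tests one vector at a time, while work with extreme points needs a
  single partner that is close at several vectors simultaneously. For convex sets the two agree: a
  closest point in finitely many coordinates yields one vector at which the support functions differ
  by at least the squared distance in those coordinates. The same device replaces separation
  theorems.

  Density of the complement of B_k(F) in F is not visibly an open condition, because F and its
  midpoints move together. It is replaced by a finite net in F, at scale 1/(k+1), none of whose
  points is nearly the midpoint of a long segment. Such a condition has room for a slack and
  survives small changes of F. One k alone gives no density of extreme points; all k together do.

  Vertices are only ever moved by adding a small multiple of a positive functional, so positivity
  costs nothing. Infinite dimension enters in the form that finitely many linear functionals have a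
  common nonzero zero.\<close>

definition sublinear :: "('a::real_vector \<Rightarrow> real) \<Rightarrow> bool" where
  "sublinear q \<longleftrightarrow> (\<forall>x y. q (x + y) \<le> q x + q y) \<and> (\<forall>c x. c \<ge> 0 \<longrightarrow> q (c *\<^sub>R x) = c * q x)"

text \<open>For c > 0 the missing inequality is the given one applied to 1/c and
  \<open>c *\<^sub>R x\<close>.\<close>

lemma sublinearI:
  assumes "\<And>x y. q (x + y) \<le> q x + q y" and "q 0 = 0"
    and "\<And>c x. c > 0 \<Longrightarrow> q (c *\<^sub>R x) \<le> c * q x"
  shows "sublinear q"
  unfolding sublinear_def
proof (intro conjI allI impI)
  fix c :: real and x assume "c \<ge> 0"
  show "q (c *\<^sub>R x) = c * q x"
  proof (cases "c = 0")
    case False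
    with \<open>c \<ge> 0\<close> have c: "c > 0" by simp
    have "q x = q (inverse c *\<^sub>R (c *\<^sub>R x))" using c by simp
    also have "\<dots> \<le> inverse c * q (c *\<^sub>R x)" using assms(3)[of "inverse c" "c *\<^sub>R x"] c by simp
    finally have "c * q x \<le> q (c *\<^sub>R x)" using c by (simp add: field_simps)
    then show ?thesis using assms(3)[OF c, of x] by linarith
  qed (use assms in auto)
qed (use assms in auto)

lemma sublinear_add: "sublinear q \<Longrightarrow> q (x + y) \<le> q x + q y"
  and sublinear_scale: "sublinear q \<Longrightarrow> c \<ge> 0 \<Longrightarrow> q (c *\<^sub>R x) = c * q x"
  by (auto simp: sublinear_def)

lemma sublinear_0: "sublinear q \<Longrightarrow> q 0 = 0"
  using sublinear_scale[of q 0 0] by simp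

lemma sublinear_minus: "sublinear q \<Longrightarrow> - q (- x) \<le> q x"
  using sublinear_add[of q x "- x"] sublinear_0[of q] by simp

lemma linear_sublinear: "linear \<sigma> \<Longrightarrow> sublinear \<sigma>"
  for \<sigma> :: "'a::real_vector \<Rightarrow> real"
  by (simp add: sublinear_def linear_add linear_scale)

text \<open>Shrinking a sublinear functional along a direction \<open>z\<close>; a functional that cannot be shrunk
  is superadditive, hence linear.\<close>

lemma sublinear_shrink:
  fixes z :: "'a::real_vector"
  assumes q: "sublinear q"
  defines "r \<equiv> \<lambda>x. INF t\<in>{0..}. q (x + t *\<^sub>R z) - t * q z"
  shows "sublinear r" "r x \<le> q x" "r x \<le> q (x + z) - q z"
proof -
  have bdd: "bdd_below ((\<lambda>t. q (x + t *\<^sub>R z) - t * q z) ` {0..})" for x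
  proof (rule bdd_belowI2)
    fix t :: real assume "t \<in> {0..}"
    then have "t * q z = q ((x + t *\<^sub>R z) + (- x))" using q by (simp add: sublinear_scale)
    also have "\<dots> \<le> q (x + t *\<^sub>R z) + q (- x)" by (rule sublinear_add[OF q])
    finally show "- q (- x) \<le> q (x + t *\<^sub>R z) - t * q z" by simp
  qed
  have le: "r x \<le> q (x + t *\<^sub>R z) - t * q z" if "t \<ge> 0" for x t
    unfolding r_def using bdd that by (intro cINF_lower) auto
  show "r x \<le> q x" for x using le[of 0 x] by simp
  show "r x \<le> q (x + z) - q z" for x using le[of 1 x] by simp
  have gr: "m \<le> r x" if "\<And>t. t \<ge> 0 \<Longrightarrow> m \<le> q (x + t *\<^sub>R z) - t * q z" for m x
    unfolding r_def using that by (intro cINF_greatest) auto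
  show "sublinear r"
  proof (rule sublinearI)
    fix x y
    \<comment> \<open>The two infima are taken in turn, over \<open>s\<close> with \<open>t\<close>
      fixed and then over \<open>t\<close>; the parameter \<open>s + t\<close> serves for
      \<open>x + y\<close>.\<close>
    have "r (x + y) - (q (y + t *\<^sub>R z) - t * q z) \<le> r x" if t: "t \<ge> 0" for t
    proof (rule gr)
      fix s :: real assume s: "s \<ge> 0"
      have "r (x + y) \<le> q ((x + s *\<^sub>R z) + (y + t *\<^sub>R z)) - (s + t) * q z"
        using le[of "s + t" "x + y"] s t by (simp add: algebra_simps)
      also have "\<dots> \<le> q (x + s *\<^sub>R z) + q (y + t *\<^sub>R z) - (s + t) * q z"
        using sublinear_add[OF q] by simp
      finally show "r (x + y) - (q (y + t *\<^sub>R z) - t * q z) \<le> q (x + s *\<^sub>R z) - s * q z"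
        by (simp add: algebra_simps)
    qed
    then have "r (x + y) - r x \<le> q (y + t *\<^sub>R z) - t * q z" if "t \<ge> 0" for t
      using that by (simp add: diff_le_eq add.commute)
    then have "r (x + y) - r x \<le> r y" by (rule gr)
    then show "r (x + y) \<le> r x + r y" by simp
  next
    have "0 \<le> r 0" by (rule gr) (simp add: sublinear_scale[OF q])
    then show "r 0 = 0" using le[of 0 0] sublinear_0[OF q] by simp
  next
    fix c :: real and x assume c: "c > 0"
    have "r (c *\<^sub>R x) / c \<le> r x"
    proof (rule gr)
      fix t :: real assume t: "t \<ge> 0"
      have "r (c *\<^sub>R x) \<le> q (c *\<^sub>R (x + t *\<^sub>R z)) - (c * t) * q z"
        using le[of "c * t" "c *\<^sub>R x"] c t by (simp add: algebra_simps)
      also have "\<dots> = c * (q (x + t *\<^sub>R z) - t * q z)"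
        unfolding sublinear_scale[OF q less_imp_le[OF c]] by (simp add: algebra_simps)
      finally show "r (c *\<^sub>R x) / c \<le> q (x + t *\<^sub>R z) - t * q z"
        using c by (simp add: field_simps)
    qed
    then show "r (c *\<^sub>R x) \<le> c * r x" using c by (simp add: field_simps)
  qed
qed

text \<open>Lower bounds for Zorn's lemma. The infimum is finite because \<open>- p (- x)\<close>
  lies below every member. Subadditivity has to mix two members; since they are comparable, the
  smaller one can be used at both points.\<close>

lemma sublinear_chain_INF:
  fixes p :: "'a::real_vector \<Rightarrow> real"
  assumes C: "C \<noteq> {}" "\<And>q. q \<in> C \<Longrightarrow> sublinear q \<and> (\<forall>x. q x \<le> p x)"
    and ch: "\<And>q r. q \<in> C \<Longrightarrow> r \<in> C \<Longrightarrow> (\<forall>x. q x \<le> r x) \<or> (\<forall>x. r x \<le> q x)"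
  defines "m \<equiv> \<lambda>x. INF q\<in>C. q x"
  shows "sublinear m" "\<And>q x. q \<in> C \<Longrightarrow> m x \<le> q x"
proof -
  have bdd: "bdd_below ((\<lambda>q. q x) ` C)" for x
  proof (rule bdd_belowI2)
    fix q assume "q \<in> C"
    with C(2)[of q] have "- q (- x) \<le> q x" "q (- x) \<le> p (- x)" by (auto simp: sublinear_minus)
    then show "- p (- x) \<le> q x" by linarith
  qed
  show le: "m x \<le> q x" if "q \<in> C" for q x
    unfolding m_def using bdd that by (intro cINF_lower) auto
  have gr: "l \<le> m x" if "\<And>q. q \<in> C \<Longrightarrow> l \<le> q x" for l x
    unfolding m_def using that C(1) by (intro cINF_greatest) auto
  show "sublinear m"
  proof (rule sublinearI)
    fix x y
    have *: "m (x + y) \<le> q x + r y" if "q \<in> C" "r \<in> C" for q r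
    proof -
      have "m (x + y) \<le> q x + q y" "m (x + y) \<le> r x + r y"
        using le[OF that(1), of "x + y"] le[OF that(2), of "x + y"]
          C(2)[OF that(1)] C(2)[OF that(2)] sublinear_add[of q x y] sublinear_add[of r x y] by auto
      moreover have "q y \<le> r y \<or> r x \<le> q x" using ch[OF that] by blast
      ultimately show ?thesis by linarith
    qed
    have "m (x + y) - m x \<le> r y" if "r \<in> C" for r
    proof -
      have "m (x + y) - r y \<le> m x" using *[OF _ that] by (intro gr) (simp add: diff_le_eq)
      then show ?thesis by simp
    qed
    then have "m (x + y) - m x \<le> m y" by (rule gr)
    then show "m (x + y) \<le> m x + m y" by simp
  next
    show "m 0 = 0"
      using C by (simp add: m_def sublinear_0 cong: INF_cong_simp)
  next
    fix c :: real and x assume c: "c > 0"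
    have "m (c *\<^sub>R x) / c \<le> m x"
    proof (rule gr)
      fix q assume "q \<in> C"
      with le[of q "c *\<^sub>R x"] C(2)[of q] c show "m (c *\<^sub>R x) / c \<le> q x"
        by (simp add: sublinear_scale field_simps)
    qed
    then show "m (c *\<^sub>R x) \<le> c * m x" using c by (simp add: field_simps)
  qed
qed

text \<open>Attainment is arranged before Zorn's lemma is applied: shrinking \<open>p\<close> along
  \<open>y\<close> gives \<open>p' (- y) \<le> - p y\<close>, which forces every linear functional
  below \<open>p'\<close> to agree with \<open>p\<close> at \<open>y\<close>. A minimal sublinear
  functional below \<open>p'\<close> cannot be shrunk in any direction, hence is additive.\<close>

theorem hahn_banach_attained:
  fixes p :: "'a::real_vector \<Rightarrow> real"
  assumes p: "sublinear p"
  obtains f where "linear f" "\<And>x. f x \<le> p x" "f y = p y"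
proof -
  define p' where "p' = (\<lambda>x. INF t\<in>{0..}. p (x + t *\<^sub>R y) - t * p y)"
  have p': "sublinear p'" "\<And>x. p' x \<le> p x" "\<And>x. p' x \<le> p (x + y) - p y"
    unfolding p'_def by (rule sublinear_shrink[OF p])+
  define A where "A = {q. sublinear q \<and> (\<forall>x. q x \<le> p' x)}"
  have "\<exists>m\<in>A. \<forall>q\<in>A. (\<forall>x. q x \<le> m x) \<longrightarrow> q = m"
  proof (rule predicate_Zorn)
    show "partial_order_on A (relation_of (\<lambda>q r. \<forall>x. r x \<le> q x) A)"
      by (rule partial_order_on_relation_ofI) (auto intro: order_trans order_antisym simp: fun_eq_iff)
    fix C assume "C \<in> Chains (relation_of (\<lambda>q r. \<forall>x. r x \<le> q x) A)"
    then have C: "C \<subseteq> A" "\<And>q r. q \<in> C \<Longrightarrow> r \<in> C \<Longrightarrow> (\<forall>x. q x \<le> r x) \<or> (\<forall>x. r x \<le> q x)"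
      by (auto simp: Chains_def relation_of_def)
    show "\<exists>m\<in>A. \<forall>q\<in>C. \<forall>x. m x \<le> q x"
    proof (cases "C = {}")
      case True
      have "p' \<in> A" using p' by (simp add: A_def)
      with True show ?thesis by auto
    next
      case False
      define m where "m = (\<lambda>x. INF q\<in>C. q x)"
      have m: "sublinear m" "\<And>q x. q \<in> C \<Longrightarrow> m x \<le> q x"
        using sublinear_chain_INF[of C p'] False C unfolding A_def m_def by blast+
      moreover have "m x \<le> p' x" for x
        using False C(1) m(2)[of _ x] unfolding A_def by (blast intro: order_trans)
      ultimately show ?thesis unfolding A_def by blast
    qed
  qed
  then obtain m where m: "m \<in> A" and min: "\<And>q. q \<in> A \<Longrightarrow> (\<And>x. q x \<le> m x) \<Longrightarrow> q = m"
    by blast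
  have sm: "sublinear m" and mp: "\<And>x. m x \<le> p' x" using m by (auto simp: A_def)
  have add: "m (x + z) = m x + m z" for x z
  proof -
    define r where "r = (\<lambda>x. INF t\<in>{0..}. m (x + t *\<^sub>R z) - t * m z)"
    have r: "sublinear r" "\<And>x. r x \<le> m x" "\<And>x. r x \<le> m (x + z) - m z"
      using sublinear_shrink[OF sm, where z = z] unfolding r_def by auto
    have "r = m" using r mp by (intro min) (auto simp: A_def intro: order_trans)
    then show ?thesis using r(3)[of x] sublinear_add[OF sm, of x z] by simp
  qed
  have neg: "m (- x) = - m x" for x using add[of x "- x"] sublinear_0[OF sm] by simp
  have scale: "m (c *\<^sub>R x) = c * m x" for c x
  proof (cases "c \<ge> 0")
    case False
    then have "m ((- c) *\<^sub>R x) = - c * m x" by (intro sublinear_scale[OF sm]) auto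
    then show ?thesis using neg[of "c *\<^sub>R x"] by simp
  qed (rule sublinear_scale[OF sm])
  show thesis
  proof
    show "linear m" using add scale by (intro linearI) auto
    show "m x \<le> p x" for x using mp[of x] p'(2)[of x] by simp
    have "m (- y) \<le> - p y" using mp[of "- y"] p'(3)[of "- y"] sublinear_0[OF p] by simp
    then show "m y = p y" using neg[of y] mp[of y] p'(2)[of y] by simp
  qed
qed

section \<open>Sets of real functions in the product topology\<close>

lemma open_fun_basis:
  fixes U :: "('a \<Rightarrow> real) set"
  assumes "open U" "f \<in> U"
  obtains I e where "finite I" "e > 0" "\<And>g. (\<And>i. i \<in> I \<Longrightarrow> \<bar>g i - f i\<bar> < e) \<Longrightarrow> g \<in> U"
proof -
  have "openin (product_topology (\<lambda>i. euclideanreal) UNIV) U"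
    using assms(1) by (simp add: open_fun_def)
  from product_topology_open_contains_basis[OF this assms(2)]
  have "\<exists>X. f \<in> (\<Pi>\<^sub>E i\<in>UNIV. X i) \<and> (\<forall>i. open (X i)) \<and> finite {i. X i \<noteq> UNIV} \<and> (\<Pi>\<^sub>E i\<in>UNIV. X i) \<subseteq> U"
    by simp
  then obtain X where
    X: "f \<in> (\<Pi>\<^sub>E i\<in>UNIV. X i)" "\<And>i. open (X i)" "finite {i. X i \<noteq> UNIV}" "(\<Pi>\<^sub>E i\<in>UNIV. X i) \<subseteq> U"
    by blast
  define I where "I = {i. X i \<noteq> UNIV}"
  have "\<forall>i. \<exists>e>0. \<forall>y. \<bar>y - f i\<bar> < e \<longrightarrow> y \<in> X i"
  proof
    fix i
    have "f i \<in> X i" using X(1) by auto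
    with X(2)[of i] show "\<exists>e>0. \<forall>y. \<bar>y - f i\<bar> < e \<longrightarrow> y \<in> X i"
      unfolding open_dist dist_real_def by simp
  qed
  then obtain e where e: "\<And>i. e i > 0" "\<And>i y. \<bar>y - f i\<bar> < e i \<Longrightarrow> y \<in> X i"
    using choice[of "\<lambda>i e. e > 0 \<and> (\<forall>y. \<bar>y - f i\<bar> < e \<longrightarrow> y \<in> X i)"] by blast
  show thesis
  proof
    show I: "finite I" using X(3) by (simp add: I_def)
    \<comment> \<open>The extra 1 keeps the minimum meaningful when \<open>I\<close> is
      empty.\<close>
    show pos: "Min (insert 1 (e ` I)) > 0" using I e(1) by auto
    fix g assume g: "\<And>i. i \<in> I \<Longrightarrow> \<bar>g i - f i\<bar> < Min (insert 1 (e ` I))"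
    have "g i \<in> X i" for i
    proof (cases "i \<in> I")
      case True
      then have "Min (insert 1 (e ` I)) \<le> e i" using I by (intro Min_le) auto
      with g[OF True] show ?thesis by (intro e(2)) linarith
    qed (auto simp: I_def)
    then show "g \<in> U" using X(4) by (auto simp: PiE_iff)
  qed
qed

lemma open_fun_box:
  fixes f :: "'a \<Rightarrow> real"
  assumes "finite I"
  shows "open {g. \<forall>i\<in>I. \<bar>g i - f i\<bar> < e}"
proof -
  have "open {g :: 'a \<Rightarrow> real. \<forall>i\<in>I. g i \<in> {f i - e<..<f i + e}}"
    using product_topology_basis'[of I "\<lambda>i. {f i - e<..<f i + e}" "\<lambda>i. i"] assms by simp
  also have "{g :: 'a \<Rightarrow> real. \<forall>i\<in>I. g i \<in> {f i - e<..<f i + e}} = {g. \<forall>i\<in>I. \<bar>g i - f i\<bar> < e}"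
    by (auto simp: abs_less_iff)
  finally show ?thesis .
qed

lemma compact_imp_closed_fun: "compact S \<Longrightarrow> closed S" for S :: "('a \<Rightarrow> real) set"
  using compactin_imp_closedin[of "euclidean :: ('a \<Rightarrow> real) topology" S]
    Hausdorff_space_product_topology[of "\<lambda>i::'a. euclideanreal" UNIV]
  by (simp add: euclidean_product_topology)

lemma continuous_on_eval [continuous_intros]:
  "continuous_on S f \<Longrightarrow> continuous_on S (\<lambda>x. (f x :: 'a \<Rightarrow> real) i)"
  by (rule continuous_on_product_then_coordinatewise)

lemma compact_box_fun:
  fixes l r :: "'a \<Rightarrow> real"
  shows "compact {f. \<forall>x. l x \<le> f x \<and> f x \<le> r x}"
proof -
  have "compactin (product_topology (\<lambda>i. euclideanreal) UNIV) (\<Pi>\<^sub>E x\<in>UNIV. {l x..r x})"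
    by (simp add: compactin_PiE)
  moreover have "(\<Pi>\<^sub>E x\<in>UNIV. {l x..r x}) = {f. \<forall>x. l x \<le> f x \<and> f x \<le> r x}"
    by (auto simp: PiE_iff)
  ultimately show ?thesis by (simp add: euclidean_product_topology)
qed

text \<open>Variational inequality for a closest point of \<open>F\<close> with respect to the Euclidean distance of the
  coordinates in \<open>I\<close>. It replaces finite-dimensional separation theorems.\<close>

lemma projection_coords:
  fixes F :: "('a \<Rightarrow> real) set"
  assumes F: "compact F" "F \<noteq> {}" "fconvex F" and I: "finite I"
  obtains \<rho> where "\<rho> \<in> F" "\<And>\<tau>. \<tau> \<in> F \<Longrightarrow> (\<Sum>i\<in>I. (\<sigma> i - \<rho> i) * (\<tau> i - \<rho> i)) \<le> 0"
proof -
  define Q where "Q = (\<lambda>\<tau>. \<Sum>i\<in>I. (\<sigma> i - \<tau> i)\<^sup>2)"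
  have "continuous_on F Q" unfolding Q_def by (intro continuous_intros)
  then obtain \<rho> where \<rho>: "\<rho> \<in> F" "\<And>\<tau>. \<tau> \<in> F \<Longrightarrow> Q \<rho> \<le> Q \<tau>"
    using continuous_attains_inf[OF F(1,2)] by blast
  show thesis
  proof
    fix \<tau> assume \<tau>: "\<tau> \<in> F"
    define a where "a = (\<Sum>i\<in>I. (\<sigma> i - \<rho> i) * (\<tau> i - \<rho> i))"
    define b where "b = (\<Sum>i\<in>I. (\<tau> i - \<rho> i)\<^sup>2)"
    have b: "b \<ge> 0" by (simp add: b_def sum_nonneg)
    have *: "2 * a \<le> t * b" if t: "0 < t" "t \<le> 1" for t
    proof -
      have "(\<lambda>x. t * \<tau> x + (1 - t) * \<rho> x) \<in> F" using F(3) \<tau> \<rho>(1) t by (simp add: fconvex_def)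
      then have "Q \<rho> \<le> Q (\<lambda>x. t * \<tau> x + (1 - t) * \<rho> x)" by (rule \<rho>(2))
      also have "\<dots> = (\<Sum>i\<in>I. (\<sigma> i - \<rho> i)\<^sup>2 - 2 * t * ((\<sigma> i - \<rho> i) * (\<tau> i - \<rho> i)) + t\<^sup>2 * (\<tau> i - \<rho> i)\<^sup>2)"
        unfolding Q_def by (intro sum.cong refl) (simp add: power2_eq_square algebra_simps)
      also have "\<dots> = Q \<rho> - 2 * t * a + t\<^sup>2 * b"
        by (simp add: Q_def a_def b_def sum.distrib sum_subtractf sum_distrib_left)
      finally have "t * (2 * a) \<le> t * (t * b)" by (simp add: power2_eq_square algebra_simps)
      then show ?thesis using t by simp
    qed
    show "a \<le> 0"
    proof (rule ccontr)
      assume "\<not> a \<le> 0"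
      then have a: "a > 0" by simp
      \<comment> \<open>This parameter lies in (0, 1] and is so small that its product with
        \<open>b\<close> is at most \<open>a\<close>, which contradicts the bound
        \<open>2 * a\<close>.\<close>
      have "2 * a \<le> min 1 (a / (b + 1)) * b" using a b by (intro *) auto
      also have "\<dots> \<le> a / (b + 1) * b" using b by (intro mult_right_mono) auto
      also have "\<dots> \<le> a" using a b by (simp add: field_simps)
      finally show False using a by simp
    qed
  qed (rule \<rho>)
qed

text \<open>One partner has to serve all coordinates of \<open>I\<close> at once; for general sets
  this is more than closeness at each coordinate separately. The strict bound is imposed element by
  element, so that no supremum is formed.\<close>

definition hclose :: "'a set \<Rightarrow> real \<Rightarrow> ('a \<Rightarrow> real) set \<Rightarrow> ('a \<Rightarrow> real) set \<Rightarrow> bool" where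
  "hclose I e F G \<longleftrightarrow> (\<forall>\<sigma>\<in>F. \<exists>\<tau>\<in>G. \<forall>i\<in>I. \<bar>\<sigma> i - \<tau> i\<bar> < e) \<and> (\<forall>\<tau>\<in>G. \<exists>\<sigma>\<in>F. \<forall>i\<in>I. \<bar>\<sigma> i - \<tau> i\<bar> < e)"

lemma hclose_refl: "e > 0 \<Longrightarrow> hclose I e F F"
  unfolding hclose_def by (auto intro!: bexI)

lemma hclose_trans:
  assumes FG: "hclose I e F G" and GK: "hclose I d G K"
  shows "hclose I (e + d) F K"
proof -
  have tri: "\<forall>i\<in>I. \<bar>\<sigma> i - \<kappa> i\<bar> < e + d"
    if "\<forall>i\<in>I. \<bar>\<sigma> i - \<tau> i\<bar> < e" "\<forall>i\<in>I. \<bar>\<tau> i - \<kappa> i\<bar> < d" for \<sigma> \<tau> \<kappa> :: "'a \<Rightarrow> real"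
  proof
    fix i assume "i \<in> I"
    then have "\<bar>\<sigma> i - \<tau> i\<bar> < e" "\<bar>\<tau> i - \<kappa> i\<bar> < d" using that by auto
    then show "\<bar>\<sigma> i - \<kappa> i\<bar> < e + d" by linarith
  qed
  have "\<exists>\<kappa>\<in>K. \<forall>i\<in>I. \<bar>\<sigma> i - \<kappa> i\<bar> < e + d" if \<sigma>: "\<sigma> \<in> F" for \<sigma>
  proof -
    obtain \<tau> where \<tau>: "\<tau> \<in> G" "\<forall>i\<in>I. \<bar>\<sigma> i - \<tau> i\<bar> < e" using FG \<sigma> unfolding hclose_def by blast
    obtain \<kappa> where \<kappa>: "\<kappa> \<in> K" "\<forall>i\<in>I. \<bar>\<tau> i - \<kappa> i\<bar> < d" using GK \<tau>(1) unfolding hclose_def by blast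
    show ?thesis using \<kappa>(1) tri[OF \<tau>(2) \<kappa>(2)] by blast
  qed
  moreover have "\<exists>\<sigma>\<in>F. \<forall>i\<in>I. \<bar>\<sigma> i - \<kappa> i\<bar> < e + d" if \<kappa>: "\<kappa> \<in> K" for \<kappa>
  proof -
    obtain \<tau> where \<tau>: "\<tau> \<in> G" "\<forall>i\<in>I. \<bar>\<tau> i - \<kappa> i\<bar> < d" using GK \<kappa> unfolding hclose_def by blast
    obtain \<sigma> where \<sigma>: "\<sigma> \<in> F" "\<forall>i\<in>I. \<bar>\<sigma> i - \<tau> i\<bar> < e" using FG \<tau>(1) unfolding hclose_def by blast
    show ?thesis using \<sigma>(1) tri[OF \<sigma>(2) \<tau>(2)] by blast
  qed
  ultimately show ?thesis unfolding hclose_def by blast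
qed

text \<open>A supremum of numbers below \<open>r\<close> may equal \<open>r\<close>, so strictness
  is recovered by a radius \<open>r\<close> smaller than \<open>e\<close>.\<close>

lemma dH_less_iff: "dH A F G < ereal e \<longleftrightarrow> (\<exists>r<e. hclose {A} r F G)"
proof
  assume "dH A F G < ereal e"
  then obtain r where r: "dH A F G < ereal r" "ereal r < ereal e" using ereal_dense2 by blast
  have "(INF \<tau>\<in>G. ereal \<bar>\<sigma> A - \<tau> A\<bar>) < ereal r" if "\<sigma> \<in> F" for \<sigma>
  proof -
    have "(INF \<tau>\<in>G. ereal \<bar>\<sigma> A - \<tau> A\<bar>) \<le> (SUP \<sigma>\<in>F. INF \<tau>\<in>G. ereal \<bar>\<sigma> A - \<tau> A\<bar>)"
      using that by (rule SUP_upper)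
    also have "\<dots> \<le> dH A F G" by (simp add: dH_def)
    finally show ?thesis using r(1) by (rule le_less_trans)
  qed
  moreover have "(INF \<sigma>\<in>F. ereal \<bar>\<sigma> A - \<tau> A\<bar>) < ereal r" if "\<tau> \<in> G" for \<tau>
  proof -
    have "(INF \<sigma>\<in>F. ereal \<bar>\<sigma> A - \<tau> A\<bar>) \<le> (SUP \<tau>\<in>G. INF \<sigma>\<in>F. ereal \<bar>\<sigma> A - \<tau> A\<bar>)"
      using that by (rule SUP_upper)
    also have "\<dots> \<le> dH A F G" by (simp add: dH_def)
    finally show ?thesis using r(1) by (rule le_less_trans)
  qed
  ultimately have "hclose {A} r F G" unfolding hclose_def by (simp add: INF_less_iff)
  then show "\<exists>r<e. hclose {A} r F G" using r(2) by auto
next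
  assume "\<exists>r<e. hclose {A} r F G"
  then obtain r where r: "r < e" "hclose {A} r F G" by blast
  have "(SUP \<sigma>\<in>F. INF \<tau>\<in>G. ereal \<bar>\<sigma> A - \<tau> A\<bar>) \<le> ereal r"
  proof (rule SUP_least)
    fix \<sigma> assume "\<sigma> \<in> F"
    then obtain \<tau> where "\<tau> \<in> G" "\<bar>\<sigma> A - \<tau> A\<bar> < r" using r(2) unfolding hclose_def by blast
    then show "(INF \<tau>\<in>G. ereal \<bar>\<sigma> A - \<tau> A\<bar>) \<le> ereal r" by (intro INF_lower2) auto
  qed
  moreover have "(SUP \<tau>\<in>G. INF \<sigma>\<in>F. ereal \<bar>\<sigma> A - \<tau> A\<bar>) \<le> ereal r"
  proof (rule SUP_least)
    fix \<tau> assume "\<tau> \<in> G"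
    then obtain \<sigma> where "\<sigma> \<in> F" "\<bar>\<sigma> A - \<tau> A\<bar> < r" using r(2) unfolding hclose_def by blast
    then show "(INF \<sigma>\<in>F. ereal \<bar>\<sigma> A - \<tau> A\<bar>) \<le> ereal r" by (intro INF_lower2) auto
  qed
  ultimately have "dH A F G \<le> ereal r" unfolding dH_def by simp
  also have "\<dots> < ereal e" using r(1) by simp
  finally show "dH A F G < ereal e" .
qed

lemma inverse_Suc_antimono: "m \<le> n \<Longrightarrow> 1 / real (Suc n) \<le> 1 / real (Suc m)"
  by (rule divide_left_mono) auto

section \<open>Order unit spaces and their positive functionals\<close>

text \<open>What remains of the topology once it is expressed by \<open>u\<close>:
  \<open>infinitesimal\<close> is the Hausdorff property and \<open>dense\<close> is separability,
  both for the order unit seminorm. Positive slack appears throughout because \<open>P\<close> need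
  not be closed nor contain 0.\<close>

locale order_unit_space =
  fixes P :: "'a::real_vector set" and u :: 'a and a :: "nat \<Rightarrow> 'a"
  assumes cone: "cvx_cone P"
    and unit: "u \<in> P"
    and absorbing: "\<And>x. \<exists>t>0. t *\<^sub>R u - x \<in> P"
    and infinitesimal: "\<And>y. (\<And>t. t > 0 \<Longrightarrow> t *\<^sub>R u - y \<in> P \<and> t *\<^sub>R u + y \<in> P) \<Longrightarrow> y = 0"
    and dense: "\<And>x e. e > 0 \<Longrightarrow> \<exists>n. e *\<^sub>R u - (x - a n) \<in> P \<and> e *\<^sub>R u + (x - a n) \<in> P"
    and infinite_dimensional: "\<And>B. finite B \<Longrightarrow> span B \<noteq> (UNIV :: 'a set)"
begin

lemma cone_add: "x \<in> P \<Longrightarrow> y \<in> P \<Longrightarrow> x + y \<in> P"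
  and cone_scale: "c > 0 \<Longrightarrow> x \<in> P \<Longrightarrow> c *\<^sub>R x \<in> P"
  using cone by (auto simp: cvx_cone_def)

lemma unit_mono:
  assumes "s *\<^sub>R u - x \<in> P" "s \<le> t"
  shows "t *\<^sub>R u - x \<in> P"
\<comment> \<open>Equality is a separate case because the increment would be 0, which need not
  belong to \<open>P\<close>.\<close>
proof (cases "s = t")
  case False
  then have "(t - s) *\<^sub>R u + (s *\<^sub>R u - x) \<in> P"
    using assms unit by (intro cone_add cone_scale) auto
  then show ?thesis by (simp add: algebra_simps)
qed (use assms in simp)

lemma unit_bound_exists: "\<exists>t>0. t *\<^sub>R u - x \<in> P \<and> t *\<^sub>R u + x \<in> P"
proof -
  obtain s t where st: "s > 0" "s *\<^sub>R u - x \<in> P" "t *\<^sub>R u - (- x) \<in> P"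
    using absorbing[of x] absorbing[of "- x"] by blast
  then have "max s t > 0" "max s t *\<^sub>R u - x \<in> P" "max s t *\<^sub>R u - (- x) \<in> P"
    using unit_mono[OF st(2), of "max s t"] unit_mono[OF st(3), of "max s t"] by simp_all
  then show ?thesis unfolding diff_minus_eq_add by blast
qed

text \<open>Some bound for the order unit seminorm of \<open>x\<close>. Choosing any admissible
  value instead of the infimum avoids the question whether the infimum is attained.\<close>

definition unit_bound :: "'a \<Rightarrow> real" where
  "unit_bound x = (SOME t. t > 0 \<and> t *\<^sub>R u - x \<in> P \<and> t *\<^sub>R u + x \<in> P)"

lemma unit_bound: "unit_bound x > 0" "unit_bound x *\<^sub>R u - x \<in> P" "unit_bound x *\<^sub>R u + x \<in> P"
  using someI_ex[OF unit_bound_exists[of x]] by (auto simp: unit_bound_def)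

definition Pdual :: "('a \<Rightarrow> real) set" where
  "Pdual = {\<sigma>. linear \<sigma> \<and> (\<forall>x\<in>P. \<sigma> x \<ge> 0)}"

text \<open>A positive functional is automatically continuous, and a set of them is equicontinuous iff it is
  bounded at \<open>u\<close>; so this is the hyperspace of the theorem with the topology eliminated.\<close>

definition CUp :: "('a \<Rightarrow> real) set set" where
  "CUp = {F. F \<noteq> {} \<and> fconvex F \<and> closed F \<and> F \<subseteq> Pdual \<and> (\<exists>c. \<forall>\<sigma>\<in>F. \<sigma> u \<le> c)}"

definition Dp :: "('a \<Rightarrow> real) set set" where
  "Dp = {F \<in> CUp. F = closure (fextreme_points F)}"

text \<open>For sublinear \<open>h\<close> the second condition means monotonicity in the cone
  order. It also makes every linear functional below \<open>h\<close> positive.\<close>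

definition cone_sublinear :: "('a \<Rightarrow> real) set" where
  "cone_sublinear = {h. sublinear h \<and> (\<forall>x\<in>P. h (- x) \<le> 0)}"

definition supp :: "('a \<Rightarrow> real) set \<Rightarrow> 'a \<Rightarrow> real" where
  "supp F x = (SUP \<sigma>\<in>F. \<sigma> x)"

definition CUp_top :: "('a \<Rightarrow> real) set topology" where
  "CUp_top = subtopology wstar_hausdorff CUp"

section \<open>Bounds and compactness from the value at the order unit\<close>

lemma Pdual_linear: "\<sigma> \<in> Pdual \<Longrightarrow> linear \<sigma>" and Pdual_nonneg: "\<sigma> \<in> Pdual \<Longrightarrow> x \<in> P \<Longrightarrow> \<sigma> x \<ge> 0"
  by (auto simp: Pdual_def)

lemma Pdual_subset_cone_sublinear: "Pdual \<subseteq> cone_sublinear"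
  by (auto simp: Pdual_def cone_sublinear_def linear_sublinear linear_neg)

text \<open>Both \<open>x\<close> and \<open>- x\<close> lie below \<open>t *\<^sub>R u\<close> in
  the cone order, and \<open>h\<close> is monotone.\<close>

lemma cone_sublinear_bound_on:
  assumes h: "h \<in> cone_sublinear" and t: "t \<ge> 0" "t *\<^sub>R u - x \<in> P" "t *\<^sub>R u + x \<in> P"
  shows "\<bar>h x\<bar> \<le> t * h u"
proof -
  have s: "sublinear h" and n: "\<And>x. x \<in> P \<Longrightarrow> h (- x) \<le> 0" using h by (auto simp: cone_sublinear_def)
  have *: "h x \<le> t * h u" if "t *\<^sub>R u - x \<in> P" for x
  proof -
    have "h (t *\<^sub>R u + - (t *\<^sub>R u - x)) \<le> h (t *\<^sub>R u) + h (- (t *\<^sub>R u - x))"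
      by (rule sublinear_add[OF s])
    then show ?thesis using n[OF that] sublinear_scale[OF s t(1), of u] by simp
  qed
  have "h x \<le> t * h u" "h (- x) \<le> t * h u" using t by (auto intro!: *)
  then show ?thesis using sublinear_minus[OF s, of x] by linarith
qed

lemma cone_sublinear_bound: "h \<in> cone_sublinear \<Longrightarrow> \<bar>h x\<bar> \<le> unit_bound x * h u"
  using unit_bound[of x] by (intro cone_sublinear_bound_on) auto

lemma Pdual_bound: "\<sigma> \<in> Pdual \<Longrightarrow> \<bar>\<sigma> x\<bar> \<le> unit_bound x * \<sigma> u"
  using cone_sublinear_bound Pdual_subset_cone_sublinear by blast

lemma Pdual_diff_bound:
  assumes "\<sigma> \<in> Pdual" "t > 0" "t *\<^sub>R u - (x - y) \<in> P" "t *\<^sub>R u + (x - y) \<in> P"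
  shows "\<bar>\<sigma> x - \<sigma> y\<bar> \<le> t * \<sigma> u"
  using cone_sublinear_bound_on[of \<sigma> t "x - y"] assms Pdual_subset_cone_sublinear Pdual_linear[of \<sigma>]
  by (auto simp: linear_diff)

text \<open>Each defining condition is a closed relation between finitely many values of
  \<open>h\<close>. Continuity of functionals, which is not of this kind, does not occur.\<close>

lemma closed_cone_sublinear: "closed cone_sublinear"
proof -
  have "cone_sublinear = (\<Inter>x. \<Inter>y. {h. h (x + y) \<le> h x + h y}) \<inter> (\<Inter>c\<in>{0..}. \<Inter>x. {h. h (c *\<^sub>R x) = c * h x})
      \<inter> (\<Inter>x\<in>P. {h. h (- x) \<le> 0})"
    by (auto simp: cone_sublinear_def sublinear_def)
  also have "closed \<dots>"
    by (intro closed_Int closed_INT ballI closed_Collect_le closed_Collect_eq continuous_intros)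
  finally show ?thesis .
qed

lemma closed_Pdual: "closed Pdual"
proof -
  have "Pdual = (\<Inter>x. \<Inter>y. {h. h (x + y) = h x + h y}) \<inter> (\<Inter>c. \<Inter>x. {h. h (c *\<^sub>R x) = c * h x})
      \<inter> (\<Inter>x\<in>P. {h. 0 \<le> h x})"
    by (auto simp: Pdual_def linear_iff)
  also have "closed \<dots>"
    by (intro closed_Int closed_INT ballI closed_Collect_le closed_Collect_eq continuous_intros)
  finally show ?thesis .
qed

text \<open>The bound at \<open>u\<close> confines every value of \<open>h\<close> to an interval,
  so Tychonoff's theorem applies. Since positive functionals belong to
  \<open>cone_sublinear\<close>, this also takes the place of the Banach-Alaoglu theorem for members
  of \<open>CUp\<close>.\<close>

lemma compact_cone_sublinear_bounded: "compact {h \<in> cone_sublinear. h u \<le> c}"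
proof -
  have "{h \<in> cone_sublinear. h u \<le> c} = (cone_sublinear \<inter> {h. h u \<le> c}) \<inter> {h. \<forall>x. - (unit_bound x * c) \<le> h x \<and> h x \<le> unit_bound x * c}"
  proof (intro equalityI subsetI)
    fix h assume h: "h \<in> {h \<in> cone_sublinear. h u \<le> c}"
    have "\<bar>h x\<bar> \<le> unit_bound x * c" for x
    proof -
      have "\<bar>h x\<bar> \<le> unit_bound x * h u" using h by (auto intro: cone_sublinear_bound)
      also have "\<dots> \<le> unit_bound x * c" using h unit_bound(1)[of x] by (intro mult_left_mono) auto
      finally show ?thesis .
    qed
    then have "- (unit_bound x * c) \<le> h x \<and> h x \<le> unit_bound x * c" for x
      unfolding abs_le_iff by (simp add: minus_le_iff)
    then show "h \<in> (cone_sublinear \<inter> {h. h u \<le> c}) \<inter> {h. \<forall>x. - (unit_bound x * c) \<le> h x \<and> h x \<le> unit_bound x * c}"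
      using h by simp
  qed auto
  moreover have "closed (cone_sublinear \<inter> {h. h u \<le> c})"
    by (intro closed_Int closed_cone_sublinear closed_Collect_le continuous_intros)
  ultimately show ?thesis
    by (simp only: closed_Int_compact[OF _ compact_box_fun])
qed

lemma CUpD:
  assumes "F \<in> CUp"
  shows "F \<noteq> {}" "fconvex F" "closed F" "F \<subseteq> Pdual" "\<exists>c. \<forall>\<sigma>\<in>F. \<sigma> u \<le> c" "compact F"
proof -
  show *: "F \<noteq> {}" "fconvex F" "closed F" "F \<subseteq> Pdual" "\<exists>c. \<forall>\<sigma>\<in>F. \<sigma> u \<le> c"
    using assms by (auto simp: CUp_def)
  then obtain c where "F \<inter> {h \<in> cone_sublinear. h u \<le> c} = F" using Pdual_subset_cone_sublinear by blast
  then show "compact F" using closed_Int_compact[OF *(3) compact_cone_sublinear_bounded[of c]] by simp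
qed

lemma CUp_linear: "F \<in> CUp \<Longrightarrow> \<sigma> \<in> F \<Longrightarrow> linear \<sigma>"
  using CUpD(4) Pdual_linear by blast

lemma CUp_bdd_above: 
  assumes "F \<in> CUp"
  shows "bdd_above ((\<lambda>\<sigma>. \<sigma> x) ` F)"
proof -
  obtain c where c: "\<And>\<sigma>. \<sigma> \<in> F \<Longrightarrow> \<sigma> u \<le> c" using CUpD(5)[OF assms] by blast
  show ?thesis
  proof (rule bdd_aboveI2)
    fix \<sigma> assume \<sigma>: "\<sigma> \<in> F"
    have "\<sigma> x \<le> unit_bound x * \<sigma> u" using Pdual_bound[of \<sigma> x] \<sigma> CUpD(4)[OF assms] by auto
    also have "\<dots> \<le> unit_bound x * c" using c[OF \<sigma>] unit_bound(1)[of x] by (intro mult_left_mono) auto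
    finally show "\<sigma> x \<le> unit_bound x * c" .
  qed
qed

section \<open>Support functions and the sets they determine\<close>

lemma supp_upper: "F \<in> CUp \<Longrightarrow> \<sigma> \<in> F \<Longrightarrow> \<sigma> x \<le> supp F x"
  unfolding supp_def by (rule cSUP_upper) (auto intro: CUp_bdd_above)

lemma supp_least: "F \<in> CUp \<Longrightarrow> (\<And>\<sigma>. \<sigma> \<in> F \<Longrightarrow> \<sigma> x \<le> m) \<Longrightarrow> supp F x \<le> m"
  unfolding supp_def using CUpD(1) by (intro cSUP_least) auto

lemma supp_in_cone_sublinear:
  assumes F: "F \<in> CUp"
  shows "supp F \<in> cone_sublinear"
  unfolding cone_sublinear_def
proof (intro CollectI conjI ballI sublinearI)
  fix x y
  show "supp F (x + y) \<le> supp F x + supp F y"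
    using supp_upper[OF F] by (intro supp_least[OF F]) (simp add: CUp_linear[OF F] linear_add add_mono)
next
  have "\<And>\<sigma>. \<sigma> \<in> F \<Longrightarrow> \<sigma> 0 = 0" using CUp_linear[OF F] linear_0 by blast
  then have "supp F 0 = (SUP \<sigma>\<in>F. 0)" unfolding supp_def by (intro SUP_cong) auto
  then show "supp F 0 = 0" using CUpD(1)[OF F] by simp
next
  fix c :: real and x assume "c > 0"
  then show "supp F (c *\<^sub>R x) \<le> c * supp F x"
    using supp_upper[OF F]
    by (intro supp_least[OF F]) (simp add: CUp_linear[OF F] linear_scale mult_left_mono)
next
  fix x assume "x \<in> P"
  then show "supp F (- x) \<le> 0"
    using CUpD(4)[OF F] Pdual_nonneg
    by (intro supp_least[OF F]) (auto simp: CUp_linear[OF F] linear_neg)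
qed

text \<open>The coordinates in \<open>I\<close> are themselves vectors. By linearity the variational
  inequality of the closest point \<open>\<rho>\<close> therefore concerns the value at a single
  vector, with the squared distance as the gap.\<close>

lemma CUp_projection:
  assumes F: "F \<in> CUp" and I: "finite I" and \<sigma>: "linear \<sigma>"
  obtains \<rho> where "\<rho> \<in> F"
    "\<And>\<tau>. \<tau> \<in> F \<Longrightarrow> \<tau> (\<Sum>i\<in>I. (\<sigma> i - \<rho> i) *\<^sub>R i) \<le> \<sigma> (\<Sum>i\<in>I. (\<sigma> i - \<rho> i) *\<^sub>R i) - (\<Sum>i\<in>I. (\<sigma> i - \<rho> i)\<^sup>2)"
proof -
  obtain \<rho> where \<rho>: "\<rho> \<in> F" "\<And>\<tau>. \<tau> \<in> F \<Longrightarrow> (\<Sum>i\<in>I. (\<sigma> i - \<rho> i) * (\<tau> i - \<rho> i)) \<le> 0"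
    using projection_coords[OF CUpD(6,1,2)[OF F] I] by metis
  show thesis
  proof (rule that[OF \<rho>(1)])
    fix \<tau> assume \<tau>: "\<tau> \<in> F"
    have ev: "f (\<Sum>i\<in>I. (\<sigma> i - \<rho> i) *\<^sub>R i) = (\<Sum>i\<in>I. (\<sigma> i - \<rho> i) * f i)" if "linear f" for f :: "'a \<Rightarrow> real"
      using that by (simp add: linear_sum linear_scale)
    have "(\<Sum>i\<in>I. (\<sigma> i - \<rho> i) * \<tau> i) - (\<Sum>i\<in>I. (\<sigma> i - \<rho> i) * \<sigma> i) + (\<Sum>i\<in>I. (\<sigma> i - \<rho> i)\<^sup>2)
        = (\<Sum>i\<in>I. (\<sigma> i - \<rho> i) * (\<tau> i - \<rho> i))"
      unfolding sum_subtractf[symmetric] sum.distrib[symmetric]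
      by (intro sum.cong refl) (simp add: power2_eq_square algebra_simps)
    with \<rho>(2)[OF \<tau>] show "\<tau> (\<Sum>i\<in>I. (\<sigma> i - \<rho> i) *\<^sub>R i) \<le> \<sigma> (\<Sum>i\<in>I. (\<sigma> i - \<rho> i) *\<^sub>R i) - (\<Sum>i\<in>I. (\<sigma> i - \<rho> i)\<^sup>2)"
      unfolding ev[OF \<sigma>] ev[OF CUp_linear[OF F \<tau>]] by linarith
  qed
qed

text \<open>If \<open>\<sigma>\<close> lay outside the closed set \<open>F\<close>, finitely many
  coordinates would show it. A functional dominated by \<open>supp F\<close> leaves no gap at the
  vector of \<open>CUp_projection\<close>, so the closest point agrees with \<open>\<sigma>\<close>
  in those coordinates, a contradiction.\<close>

lemma mem_CUp_iff_le_supp: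
  assumes F: "F \<in> CUp"
  shows "\<sigma> \<in> F \<longleftrightarrow> linear \<sigma> \<and> (\<forall>x. \<sigma> x \<le> supp F x)"
proof (intro iffI)
  assume \<sigma>: "linear \<sigma> \<and> (\<forall>x. \<sigma> x \<le> supp F x)"
  show "\<sigma> \<in> F"
  proof (rule ccontr)
    assume "\<sigma> \<notin> F"
    moreover have "open (- F)" using CUpD(3)[OF F] by auto
    ultimately obtain I e where I: "finite I" "e > 0" "\<And>g. (\<And>i. i \<in> I \<Longrightarrow> \<bar>g i - \<sigma> i\<bar> < e) \<Longrightarrow> g \<in> - F"
      using open_fun_basis by (metis ComplI)
    obtain \<rho> where \<rho>: "\<rho> \<in> F"
      "\<And>\<tau>. \<tau> \<in> F \<Longrightarrow> \<tau> (\<Sum>i\<in>I. (\<sigma> i - \<rho> i) *\<^sub>R i) \<le> \<sigma> (\<Sum>i\<in>I. (\<sigma> i - \<rho> i) *\<^sub>R i) - (\<Sum>i\<in>I. (\<sigma> i - \<rho> i)\<^sup>2)"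
      using CUp_projection[OF F I(1)] \<sigma> by blast
    let ?x = "\<Sum>i\<in>I. (\<sigma> i - \<rho> i) *\<^sub>R i"
    have "supp F ?x \<le> \<sigma> ?x - (\<Sum>i\<in>I. (\<sigma> i - \<rho> i)\<^sup>2)" using \<rho>(2) by (rule supp_least[OF F])
    then have "(\<Sum>i\<in>I. (\<sigma> i - \<rho> i)\<^sup>2) \<le> 0" using \<sigma> by (smt (verit))
    then have "\<forall>i\<in>I. (\<sigma> i - \<rho> i)\<^sup>2 = 0"
      using sum_nonneg_eq_0_iff[OF I(1), of "\<lambda>i. (\<sigma> i - \<rho> i)\<^sup>2"] sum_nonneg[of I "\<lambda>i. (\<sigma> i - \<rho> i)\<^sup>2"] by force
    then have "\<rho> \<in> - F" using I(2) by (intro I(3)) auto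
    then show False using \<rho>(1) by simp
  qed
qed (use CUp_linear[OF F] supp_upper[OF F] in auto)

lemma inj_on_supp: "inj_on supp CUp"
proof (rule inj_onI, rule set_eqI)
  fix F G \<sigma> assume "F \<in> CUp" "G \<in> CUp" and eq: "supp F = supp G"
  then show "\<sigma> \<in> F \<longleftrightarrow> \<sigma> \<in> G" by (simp only: mem_CUp_iff_le_supp eq)
qed

text \<open>The candidate is the set of all linear functionals below \<open>h\<close>. Its support
  function reaches \<open>h\<close> at every point because Hahn-Banach provides a functional
  touching \<open>h\<close> there.\<close>

lemma supp_surj:
  assumes h: "h \<in> cone_sublinear"
  shows "h \<in> supp ` CUp"
proof -
  define F where "F = {\<sigma>. linear \<sigma> \<and> (\<forall>x. \<sigma> x \<le> h x)}"
  have s: "sublinear h" and n: "\<And>x. x \<in> P \<Longrightarrow> h (- x) \<le> 0" using h by (auto simp: cone_sublinear_def)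
  have "F \<noteq> {}" by (rule hahn_banach_attained[OF s, of 0]) (auto simp: F_def)
  moreover have "fconvex F"
    unfolding fconvex_def
  proof (intro ballI allI impI)
    fix \<sigma> \<tau> and t :: real assume *: "\<sigma> \<in> F" "\<tau> \<in> F" "0 \<le> t \<and> t \<le> 1"
    have "t * \<sigma> x + (1 - t) * \<tau> x \<le> h x" for x
    proof -
      have "t * \<sigma> x + (1 - t) * \<tau> x \<le> t * h x + (1 - t) * h x"
        using * by (intro add_mono mult_left_mono) (auto simp: F_def)
      then show ?thesis by (simp add: algebra_simps)
    qed
    then show "(\<lambda>A. t * \<sigma> A + (1 - t) * \<tau> A) \<in> F"
      using * by (simp add: F_def linear_iff distrib_left right_diff_distrib left_diff_distrib)
  qed
  moreover have "closed F"
  proof -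
    have "F = (\<Inter>x. \<Inter>y. {\<sigma>. \<sigma> (x + y) = \<sigma> x + \<sigma> y}) \<inter> (\<Inter>c. \<Inter>x. {\<sigma>. \<sigma> (c *\<^sub>R x) = c * \<sigma> x})
      \<inter> (\<Inter>x. {\<sigma>. \<sigma> x \<le> h x})"
      by (auto simp: F_def linear_iff)
    also have "closed \<dots>"
      by (intro closed_Int closed_INT ballI closed_Collect_le closed_Collect_eq continuous_intros)
    finally show ?thesis .
  qed
  moreover have "F \<subseteq> Pdual"
  proof
    fix \<sigma> assume \<sigma>: "\<sigma> \<in> F"
    have "0 \<le> \<sigma> x" if "x \<in> P" for x
    proof -
      have "\<sigma> (- x) \<le> h (- x)" "linear \<sigma>" using \<sigma> by (auto simp: F_def)
      then show ?thesis using n[OF that] by (simp add: linear_neg)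
    qed
    then show "\<sigma> \<in> Pdual" using \<sigma> by (auto simp: F_def Pdual_def)
  qed
  ultimately have F: "F \<in> CUp" unfolding CUp_def by (auto simp: F_def)
  have "supp F x = h x" for x
  proof (rule antisym)
    show "supp F x \<le> h x" by (rule supp_least[OF F]) (simp add: F_def)
    obtain f where "linear f" "\<And>z. f z \<le> h z" "f x = h x"
      by (rule hahn_banach_attained[OF s, where y = x]) blast
    then show "h x \<le> supp F x" using supp_upper[OF F, of f x] by (simp add: F_def)
  qed
  then have "supp F = h" by (rule ext)
  then show ?thesis using F by blast
qed

lemma supp_image: "supp ` CUp = cone_sublinear"
  using supp_in_cone_sublinear supp_surj by auto

section \<open>The hypertopology as pointwise convergence of support functions\<close>

text \<open>The coefficients of the vector supplied by \<open>CUp_projection\<close> stay in a fixed bounded box, so that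
  they may be rounded to a finite grid \<open>J\<close> chosen in advance.\<close>

lemma supp_close_imp_one_sided:
  assumes I: "finite I" and e: "e > 0"
  obtains J d where "finite J" "d > 0"
    "\<And>F G \<sigma>. F \<in> CUp \<Longrightarrow> G \<in> CUp \<Longrightarrow> (\<And>\<tau>. \<tau> \<in> F \<union> G \<Longrightarrow> \<tau> u \<le> c) \<Longrightarrow>
      (\<And>x. x \<in> J \<Longrightarrow> supp F x - supp G x < d) \<Longrightarrow> \<sigma> \<in> F \<Longrightarrow> \<exists>\<tau>\<in>G. \<forall>i\<in>I. \<bar>\<sigma> i - \<tau> i\<bar> < e"
proof -
  define C where "C = 1 + (\<Sum>i\<in>I. unit_bound i * max c 0)"
  have Npos: "unit_bound i * max c 0 \<ge> 0" for i using unit_bound(1)[of i] by simp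
  have "(\<Sum>i\<in>I. unit_bound i * max c 0) \<ge> 0" using Npos by (rule sum_nonneg)
  then have C: "C > 0" unfolding C_def by linarith
  have bound: "\<bar>\<tau> i\<bar> \<le> C" if "\<tau> \<in> Pdual" "\<tau> u \<le> c" "i \<in> I" for \<tau> i
  proof -
    have "\<bar>\<tau> i\<bar> \<le> unit_bound i * \<tau> u" using that by (intro Pdual_bound)
    also have "\<dots> \<le> unit_bound i * max c 0" using that unit_bound(1)[of i] by (intro mult_left_mono) auto
    also have "\<dots> \<le> (\<Sum>i\<in>I. unit_bound i * max c 0)" using that(3) I Npos by (intro member_le_sum) auto
    finally show ?thesis by (simp add: C_def)
  qed
  \<comment> \<open>The grid has mesh 1/M. Rounding changes the value of any functional bounded by
    \<open>C\<close> on \<open>I\<close> by at most \<open>b\<close>, and \<open>M\<close> is chosen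
    to make \<open>2 * b\<close> at most half of the square of \<open>e\<close>.\<close>
  obtain M :: nat where M: "real M > 4 * real (card I) * C / e\<^sup>2" using reals_Archimedean2 by blast
  have "4 * real (card I) * C / e\<^sup>2 \<ge> 0" using C by simp
  then have M0: "real M > 0" using M by linarith
  define b where "b = real (card I) * C / M"
  have b: "2 * b \<le> e\<^sup>2 / 2" using M M0 e by (simp add: b_def field_simps)
  define L where "L = \<lceil>2 * C * M\<rceil> + 1"
  define g where "g = (\<lambda>k. \<Sum>i\<in>I. (real_of_int (k i) / M) *\<^sub>R i)"
  define J where "J = g ` (PiE I (\<lambda>_. {-L..L}))"
  show thesis
  proof (rule that)
    show "finite J" unfolding J_def using I by (intro finite_imageI finite_PiE) auto
    \<comment> \<open>The squared distance \<open>Q\<close> is at most the gap between the support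
      functions at a grid vector plus \<open>2 * b\<close>; each of these gets half of the square of
      \<open>e\<close>.\<close>
    show "e\<^sup>2 / 2 > 0" using e by simp
    fix F G \<sigma> assume F: "F \<in> CUp" and G: "G \<in> CUp" and c: "\<And>\<tau>. \<tau> \<in> F \<union> G \<Longrightarrow> \<tau> u \<le> c"
      and close: "\<And>x. x \<in> J \<Longrightarrow> supp F x - supp G x < e\<^sup>2 / 2" and \<sigma>: "\<sigma> \<in> F"
    have bnd: "\<bar>\<tau> i\<bar> \<le> C" if "\<tau> \<in> F \<union> G" "i \<in> I" for \<tau> i
      using bound[of \<tau> i] c[OF that(1)] that CUpD(4)[OF F] CUpD(4)[OF G] by auto
    have lin: "linear \<tau>" if "\<tau> \<in> F \<union> G" for \<tau>
      using that CUp_linear[OF F] CUp_linear[OF G] by blast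
    obtain \<rho> where \<rho>: "\<rho> \<in> G"
      "\<And>\<tau>. \<tau> \<in> G \<Longrightarrow> \<tau> (\<Sum>i\<in>I. (\<sigma> i - \<rho> i) *\<^sub>R i) \<le> \<sigma> (\<Sum>i\<in>I. (\<sigma> i - \<rho> i) *\<^sub>R i) - (\<Sum>i\<in>I. (\<sigma> i - \<rho> i)\<^sup>2)"
      by (rule CUp_projection[OF G I lin[of \<sigma>]]) (use \<sigma> in auto)
    define x where "x = (\<Sum>i\<in>I. (\<sigma> i - \<rho> i) *\<^sub>R i)"
    define Q where "Q = (\<Sum>i\<in>I. (\<sigma> i - \<rho> i)\<^sup>2)"
    define k where "k = restrict (\<lambda>i. \<lfloor>(\<sigma> i - \<rho> i) * M\<rfloor>) I"
    have coef: "\<bar>(\<sigma> i - \<rho> i) - real_of_int (k i) / M\<bar> \<le> 1 / M" if "i \<in> I" for i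
    proof -
      have "\<bar>(\<sigma> i - \<rho> i) * M - real_of_int (k i)\<bar> \<le> 1" using that unfolding k_def by simp linarith
      then have "\<bar>(\<sigma> i - \<rho> i) * M - real_of_int (k i)\<bar> / M \<le> 1 / M"
        using M0 by (intro divide_right_mono) auto
      moreover have "\<bar>(\<sigma> i - \<rho> i) * M - real_of_int (k i)\<bar> / M = \<bar>((\<sigma> i - \<rho> i) * M - real_of_int (k i)) / M\<bar>"
        using M0 by (simp add: abs_divide)
      moreover have "((\<sigma> i - \<rho> i) * M - real_of_int (k i)) / M = (\<sigma> i - \<rho> i) - real_of_int (k i) / M"
        using M0 by (simp add: diff_divide_distrib)
      ultimately show ?thesis by simp
    qed
    have "k i \<in> {-L..L}" if i: "i \<in> I" for i
    proof -
      have "\<bar>\<sigma> i - \<rho> i\<bar> \<le> 2 * C" using bnd[of \<sigma> i] bnd[of \<rho> i] \<sigma> \<rho>(1) i by auto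
      then have "\<bar>\<sigma> i - \<rho> i\<bar> * M \<le> 2 * C * M" using M0 by (intro mult_right_mono) auto
      then have "\<bar>(\<sigma> i - \<rho> i) * M\<bar> \<le> 2 * C * M" by (simp add: abs_mult)
      then show ?thesis using i unfolding k_def L_def by simp linarith
    qed
    then have "k \<in> PiE I (\<lambda>_. {-L..L})" by (simp add: PiE_iff k_def)
    then have xJ: "g k \<in> J" unfolding J_def by blast
    have appr: "\<bar>\<tau> x - \<tau> (g k)\<bar> \<le> b" if \<tau>: "\<tau> \<in> F \<union> G" for \<tau>
    proof -
      have "\<tau> x - \<tau> (g k) = (\<Sum>i\<in>I. ((\<sigma> i - \<rho> i) - real_of_int (k i) / M) * \<tau> i)"
        unfolding x_def g_def using lin[OF \<tau>]
        by (simp add: linear_sum linear_scale sum_subtractf[symmetric] left_diff_distrib)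
      also have "\<bar>\<dots>\<bar> \<le> (\<Sum>i\<in>I. \<bar>((\<sigma> i - \<rho> i) - real_of_int (k i) / M) * \<tau> i\<bar>)" by (rule sum_abs)
      also have "\<dots> \<le> (\<Sum>i\<in>I. 1 / M * C)"
        unfolding abs_mult using coef bnd[OF \<tau>] M0 by (intro sum_mono mult_mono) auto
      also have "\<dots> = b" by (simp add: b_def)
      finally show ?thesis .
    qed
    have "supp G (g k) \<le> \<sigma> (g k) - Q + 2 * b"
    proof (rule supp_least[OF G])
      fix \<tau> assume \<tau>: "\<tau> \<in> G"
      have "\<tau> x \<le> \<sigma> x - Q" unfolding x_def Q_def by (rule \<rho>(2)[OF \<tau>])
      moreover have "\<bar>\<tau> x - \<tau> (g k)\<bar> \<le> b" "\<bar>\<sigma> x - \<sigma> (g k)\<bar> \<le> b" using \<tau> \<sigma> by (auto intro!: appr)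
      ultimately show "\<tau> (g k) \<le> \<sigma> (g k) - Q + 2 * b" unfolding abs_le_iff by linarith
    qed
    moreover have "\<sigma> (g k) \<le> supp F (g k)" by (rule supp_upper[OF F \<sigma>])
    ultimately have Q: "Q < e\<^sup>2" using close[OF xJ] b by linarith
    have "\<bar>\<sigma> i - \<rho> i\<bar> < e" if "i \<in> I" for i
    proof -
      have "(\<sigma> i - \<rho> i)\<^sup>2 \<le> Q"
        unfolding Q_def by (rule member_le_sum[OF that]) (simp_all add: I)
      then have "\<bar>\<sigma> i - \<rho> i\<bar>\<^sup>2 < e\<^sup>2" unfolding power2_abs using Q by (rule le_less_trans)
      then show ?thesis using e by (rule power2_less_imp_less[OF _ less_imp_le])
    qed
    then show "\<exists>\<tau>\<in>G. \<forall>i\<in>I. \<bar>\<sigma> i - \<tau> i\<bar> < e" using \<rho>(1) by blast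
  qed
qed

text \<open>Including \<open>u\<close> among the test vectors, with tolerance at most 1, bounds all
  admissible \<open>G\<close> by \<open>supp F u + 1\<close> at \<open>u\<close>. This is the
  uniform bound required by the one-sided statement, which is then used in both directions.\<close>

lemma supp_close_imp_hclose:
  assumes F: "F \<in> CUp" and I: "finite I" and e: "e > 0"
  obtains J d where "finite J" "d > 0"
    "\<And>G. G \<in> CUp \<Longrightarrow> (\<And>x. x \<in> J \<Longrightarrow> \<bar>supp G x - supp F x\<bar> < d) \<Longrightarrow> hclose I e F G"
proof -
  obtain J d where J: "finite J" "d > 0"
    "\<And>F' G \<sigma>. F' \<in> CUp \<Longrightarrow> G \<in> CUp \<Longrightarrow> (\<And>\<tau>. \<tau> \<in> F' \<union> G \<Longrightarrow> \<tau> u \<le> supp F u + 1) \<Longrightarrow>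
      (\<And>x. x \<in> J \<Longrightarrow> supp F' x - supp G x < d) \<Longrightarrow> \<sigma> \<in> F' \<Longrightarrow> \<exists>\<tau>\<in>G. \<forall>i\<in>I. \<bar>\<sigma> i - \<tau> i\<bar> < e"
    by (rule supp_close_imp_one_sided[OF I e, of "supp F u + 1"]) blast
  show thesis
  proof (rule that[of "insert u J" "min d 1"])
    fix G assume G: "G \<in> CUp" and close: "\<And>x. x \<in> insert u J \<Longrightarrow> \<bar>supp G x - supp F x\<bar> < min d 1"
    have uc: "\<tau> u \<le> supp F u + 1" if "\<tau> \<in> F \<union> G" for \<tau>
      using that close[of u] supp_upper[OF F, of \<tau> u] supp_upper[OF G, of \<tau> u] by auto
    have cl: "supp F x - supp G x < d" "supp G x - supp F x < d" if "x \<in> J" for x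
      using close[of x] that by auto
    have "\<exists>\<tau>\<in>G. \<forall>i\<in>I. \<bar>\<sigma> i - \<tau> i\<bar> < e" if "\<sigma> \<in> F" for \<sigma>
      using uc cl that by (intro J(3)[OF F G]) auto
    moreover have "\<exists>\<sigma>\<in>F. \<forall>i\<in>I. \<bar>\<tau> i - \<sigma> i\<bar> < e" if "\<tau> \<in> G" for \<tau>
      using uc cl that by (intro J(3)[OF G F]) auto
    ultimately show "hclose I e F G" unfolding hclose_def by (simp add: abs_minus_commute)
  qed (use J in auto)
qed

lemma hclose_imp_supp_close:
  assumes F: "F \<in> CUp" and G: "G \<in> CUp" and h: "hclose I e F G" and x: "x \<in> I"
  shows "\<bar>supp G x - supp F x\<bar> \<le> e"
proof -
  have "supp F x \<le> supp G x + e"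
  proof (rule supp_least[OF F])
    fix \<sigma> assume "\<sigma> \<in> F"
    then obtain \<tau> where "\<tau> \<in> G" "\<bar>\<sigma> x - \<tau> x\<bar> < e" using h x unfolding hclose_def by blast
    then show "\<sigma> x \<le> supp G x + e" using supp_upper[OF G, of \<tau> x] by linarith
  qed
  moreover have "supp G x \<le> supp F x + e"
  proof (rule supp_least[OF G])
    fix \<tau> assume "\<tau> \<in> G"
    then obtain \<sigma> where "\<sigma> \<in> F" "\<bar>\<sigma> x - \<tau> x\<bar> < e" using h x unfolding hclose_def by blast
    then show "\<tau> x \<le> supp F x + e" using supp_upper[OF F, of \<sigma> x] by linarith
  qed
  ultimately show ?thesis by linarith
qed

text \<open>The centre \<open>F0\<close> of a subbasic set is an arbitrary set of functions without
  a useful support function. The triangle inequality for \<open>hclose\<close> moves the centre to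
  \<open>F\<close>, using half of the remaining room \<open>e - r\<close>.\<close>

lemma openin_wstar_hausdorff_supp_nbhd:
  assumes "openin wstar_hausdorff W" "F \<in> W" and F: "F \<in> CUp"
  shows "\<exists>J d. finite J \<and> d > 0 \<and> (\<forall>G\<in>CUp. (\<forall>x\<in>J. \<bar>supp G x - supp F x\<bar> < d) \<longrightarrow> G \<in> W)"
proof -
  have "generate_topology_on {{G. dH A F G < ereal \<epsilon>} | A F \<epsilon>. \<epsilon> > 0} W"
    using assms(1) unfolding wstar_hausdorff_def by (rule openin_topology_generated_by)
  then show ?thesis using assms(2)
  proof induction
    case (Int V W)
    then have "F \<in> V" "F \<in> W" by auto
    obtain J d where J: "finite J" "d > 0" "\<forall>G\<in>CUp. (\<forall>x\<in>J. \<bar>supp G x - supp F x\<bar> < d) \<longrightarrow> G \<in> V"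
      using Int.IH(1)[OF \<open>F \<in> V\<close>] by blast
    obtain J' d' where J': "finite J'" "d' > 0" "\<forall>G\<in>CUp. (\<forall>x\<in>J'. \<bar>supp G x - supp F x\<bar> < d') \<longrightarrow> G \<in> W"
      using Int.IH(2)[OF \<open>F \<in> W\<close>] by blast
    show ?case
    proof (intro exI conjI ballI impI)
      show "finite (J \<union> J')" "min d d' > 0" using J J' by auto
      fix G assume "G \<in> CUp" "\<forall>x\<in>J \<union> J'. \<bar>supp G x - supp F x\<bar> < min d d'"
      then show "G \<in> V \<inter> W" using J(3) J'(3) by simp
    qed
  next
    case (UN K)
    then obtain V where V: "V \<in> K" "F \<in> V" by blast
    obtain J d where "finite J" "d > 0" "\<forall>G\<in>CUp. (\<forall>x\<in>J. \<bar>supp G x - supp F x\<bar> < d) \<longrightarrow> G \<in> V"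
      using UN.IH[OF V] by blast
    then show ?case using V(1) by (intro exI[of _ J] exI[of _ d]) auto
  next
    case (Basis V)
    then obtain A F0 e where V: "V = {G. dH A F0 G < ereal e}" by blast
    with Basis obtain r where r: "r < e" "hclose {A} r F0 F" by (auto simp: dH_less_iff)
    obtain J d where J: "finite J" "d > 0"
      "\<And>G. G \<in> CUp \<Longrightarrow> (\<And>x. x \<in> J \<Longrightarrow> \<bar>supp G x - supp F x\<bar> < d) \<Longrightarrow> hclose {A} ((e - r) / 2) F G"
      by (rule supp_close_imp_hclose[OF F, of "{A}" "(e - r) / 2"]) (use r in auto)
    show ?case
    proof (intro exI conjI ballI impI)
      fix G assume "G \<in> CUp" "\<forall>x\<in>J. \<bar>supp G x - supp F x\<bar> < d"
      then have "hclose {A} ((e - r) / 2) F G" by (intro J(3)) auto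
      with r(2) have "hclose {A} (r + (e - r) / 2) F0 G" by (rule hclose_trans)
      moreover have "r + (e - r) / 2 < e" using r(1) by (simp add: field_simps)
      ultimately show "G \<in> V" unfolding V mem_Collect_eq dH_less_iff by blast
    qed (use J in auto)
  qed simp
qed

lemma openin_CUp_top_iff:
  "openin CUp_top S \<longleftrightarrow> S \<subseteq> CUp \<and>
    (\<forall>F\<in>S. \<exists>J d. finite J \<and> d > 0 \<and> (\<forall>G\<in>CUp. (\<forall>x\<in>J. \<bar>supp G x - supp F x\<bar> < d) \<longrightarrow> G \<in> S))"
proof (intro iffI conjI ballI)
  assume S: "openin CUp_top S"
  then obtain W where W: "openin wstar_hausdorff W" "S = W \<inter> CUp"
    unfolding CUp_top_def openin_subtopology by blast
  then show "S \<subseteq> CUp" by blast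
  fix F assume "F \<in> S"
  then show "\<exists>J d. finite J \<and> d > 0 \<and> (\<forall>G\<in>CUp. (\<forall>x\<in>J. \<bar>supp G x - supp F x\<bar> < d) \<longrightarrow> G \<in> S)"
    using openin_wstar_hausdorff_supp_nbhd[OF W(1), of F] W(2) by blast
next
  assume S: "S \<subseteq> CUp \<and>
    (\<forall>F\<in>S. \<exists>J d. finite J \<and> d > 0 \<and> (\<forall>G\<in>CUp. (\<forall>x\<in>J. \<bar>supp G x - supp F x\<bar> < d) \<longrightarrow> G \<in> S))"
  show "openin CUp_top S"
  proof (subst openin_subopen, intro ballI)
    fix F assume "F \<in> S"
    with S have F: "F \<in> CUp" by blast
    from S \<open>F \<in> S\<close> obtain J d where J: "finite J" "d > 0"
      "\<And>G. G \<in> CUp \<Longrightarrow> \<forall>x\<in>J. \<bar>supp G x - supp F x\<bar> < d \<Longrightarrow> G \<in> S" by blast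
    \<comment> \<open>The index 0 is added so that the intersection of open sets is over a nonempty
      family even if \<open>J\<close> is empty.\<close>
    define W where "W = (\<Inter>x\<in>insert 0 J. {G. dH x F G < ereal d})"
    have "openin wstar_hausdorff W"
      unfolding W_def wstar_hausdorff_def using J(1,2)
      by (intro openin_INT2 topology_generated_by_Basis) auto
    then have "openin CUp_top (W \<inter> CUp)" unfolding CUp_top_def openin_subtopology by blast
    moreover have "F \<in> W"
    proof -
      have "hclose {x} (d / 2) F F" for x using J(2) by (intro hclose_refl) simp
      moreover have "d / 2 < d" using J(2) by simp
      ultimately have "dH x F F < ereal d" for x unfolding dH_less_iff by blast
      then show ?thesis unfolding W_def by simp
    qed
    moreover have "W \<inter> CUp \<subseteq> S"
    proof
      fix G assume G: "G \<in> W \<inter> CUp"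
      have "\<bar>supp G x - supp F x\<bar> < d" if x: "x \<in> J" for x
      proof -
        have "dH x F G < ereal d" using G x unfolding W_def by blast
        then obtain r where "r < d" "hclose {x} r F G" by (auto simp: dH_less_iff)
        then show ?thesis using hclose_imp_supp_close[OF F, of G "{x}" r x] G by auto
      qed
      then show "G \<in> S" using G J(3) by blast
    qed
    ultimately show "\<exists>T. openin CUp_top T \<and> F \<in> T \<and> T \<subseteq> S" using F by blast
  qed
qed

lemma topspace_CUp_top: "topspace CUp_top = CUp"
proof
  show "topspace CUp_top \<subseteq> CUp" by (simp add: CUp_top_def)
  have "openin CUp_top CUp" unfolding openin_CUp_top_iff by (auto intro!: exI[of _ "{}"] exI[of _ 1])
  then show "CUp \<subseteq> topspace CUp_top" by (rule openin_subset)
qed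

lemma homeomorphic_map_supp: "homeomorphic_map CUp_top (top_of_set cone_sublinear) supp"
proof (rule bijective_open_imp_homeomorphic_map)
  show "supp ` topspace CUp_top = topspace (top_of_set cone_sublinear)" by (simp add: topspace_CUp_top supp_image)
  show "inj_on supp (topspace CUp_top)" by (simp add: topspace_CUp_top inj_on_supp)
  show "continuous_map CUp_top (top_of_set cone_sublinear) supp"
    unfolding continuous_map_in_subtopology
  proof
    show "supp \<in> topspace CUp_top \<rightarrow> cone_sublinear" using supp_in_cone_sublinear by (auto simp: topspace_CUp_top)
    show "continuous_map CUp_top euclidean supp"
      unfolding continuous_map_def
    proof (intro conjI allI impI)
      fix U :: "('a \<Rightarrow> real) set" assume "openin euclidean U"
      then have U: "open U" by simp
      show "openin CUp_top {F \<in> topspace CUp_top. supp F \<in> U}"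
        unfolding openin_CUp_top_iff topspace_CUp_top
      proof (intro conjI ballI)
        fix F assume "F \<in> {F \<in> CUp. supp F \<in> U}"
        then have "supp F \<in> U" by simp
        then obtain I e where I: "finite I" "e > 0" "\<And>g. (\<And>i. i \<in> I \<Longrightarrow> \<bar>g i - supp F i\<bar> < e) \<Longrightarrow> g \<in> U"
          by (rule open_fun_basis[OF U]) blast
        then have "\<forall>G\<in>CUp. (\<forall>x\<in>I. \<bar>supp G x - supp F x\<bar> < e) \<longrightarrow> G \<in> {F \<in> CUp. supp F \<in> U}" by simp
        with I(1,2) show "\<exists>J d. finite J \<and> d > 0 \<and>
            (\<forall>G\<in>CUp. (\<forall>x\<in>J. \<bar>supp G x - supp F x\<bar> < d) \<longrightarrow> G \<in> {F \<in> CUp. supp F \<in> U})"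
          by blast
      qed auto
    qed auto
  qed
  show "open_map CUp_top (top_of_set cone_sublinear) supp"
    unfolding open_map_def
  proof (intro allI impI)
    fix S assume S: "openin CUp_top S"
    then have SC: "S \<subseteq> CUp" by (simp add: openin_CUp_top_iff)
    show "openin (top_of_set cone_sublinear) (supp ` S)"
    proof (subst openin_subopen, intro ballI)
      fix h assume "h \<in> supp ` S"
      then obtain F where F: "F \<in> S" "h = supp F" by blast
      with S obtain J d where J: "finite J" "d > 0"
        "\<And>G. G \<in> CUp \<Longrightarrow> \<forall>x\<in>J. \<bar>supp G x - supp F x\<bar> < d \<Longrightarrow> G \<in> S"
        unfolding openin_CUp_top_iff by blast
      let ?V = "{g. \<forall>i\<in>J. \<bar>g i - h i\<bar> < d}"
      have "openin (top_of_set cone_sublinear) (cone_sublinear \<inter> ?V)" using open_fun_box[OF J(1)] by (rule openin_open_Int)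
      moreover have "h \<in> cone_sublinear \<inter> ?V" using F SC supp_in_cone_sublinear J(2) by auto
      moreover have "cone_sublinear \<inter> ?V \<subseteq> supp ` S"
      proof
        fix g assume g: "g \<in> cone_sublinear \<inter> ?V"
        then obtain G where "G \<in> CUp" "g = supp G" using supp_surj by blast
        then show "g \<in> supp ` S" using J(3)[of G] g F(2) by blast
      qed
      ultimately show "\<exists>T. openin (top_of_set cone_sublinear) T \<and> h \<in> T \<and> T \<subseteq> supp ` S" by blast
    qed
  qed
qed

section \<open>Local compactness of the hyperspace\<close>

lemma Hausdorff_fun: "Hausdorff_space (top_of_set S)" for S :: "('b \<Rightarrow> real) set"
  using Hausdorff_space_product_topology[of "\<lambda>i::'b. euclideanreal" UNIV]
  by (intro Hausdorff_space_subtopology) (simp add: euclidean_product_topology)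

lemma locally_compact_cone_sublinear: "locally_compact_space (top_of_set cone_sublinear)"
  unfolding locally_compact_space_def
proof
  fix h assume h: "h \<in> topspace (top_of_set cone_sublinear)"
  have "openin (top_of_set cone_sublinear) (cone_sublinear \<inter> {g. g u < h u + 1})"
    by (intro openin_open_Int open_Collect_less continuous_intros)
  moreover have "compactin (top_of_set cone_sublinear) {g \<in> cone_sublinear. g u \<le> h u + 1}"
    using compact_cone_sublinear_bounded by (auto simp: compactin_subtopology)
  moreover have "h \<in> cone_sublinear \<inter> {g. g u < h u + 1}" using h by simp
  moreover have "cone_sublinear \<inter> {g. g u < h u + 1} \<subseteq> {g \<in> cone_sublinear. g u \<le> h u + 1}" by auto
  ultimately show "\<exists>U K. openin (top_of_set cone_sublinear) U \<and> compactin (top_of_set cone_sublinear) K \<and> h \<in> U \<and> U \<subseteq> K"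
    by blast
qed

lemma locally_compact_regular_CUp_top: "locally_compact_space CUp_top \<and> regular_space CUp_top"
proof -
  have "CUp_top homeomorphic_space top_of_set cone_sublinear"
    using homeomorphic_map_supp homeomorphic_map_imp_homeomorphic_space by blast
  moreover have "regular_space (top_of_set cone_sublinear)"
    by (rule locally_compact_Hausdorff_imp_regular_space[OF locally_compact_cone_sublinear Hausdorff_fun])
  ultimately show ?thesis
    using locally_compact_cone_sublinear homeomorphic_locally_compact_space homeomorphic_regular_space by blast
qed

section \<open>Dense extreme points as a countable intersection of open conditions\<close>

text \<open>On positive functionals bounded at \<open>u\<close>, the values along the dense sequence
  control all others uniformly. One index \<open>K\<close> bounds both the number of coordinates and
  the precision, and it may be taken as large as desired.\<close>

lemma dense_coordinates:
  assumes I: "finite I" and e: "e > 0"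
  obtains K where "K \<ge> k"
    "\<And>\<sigma> \<tau>. \<sigma> \<in> Pdual \<Longrightarrow> \<tau> \<in> Pdual \<Longrightarrow> \<sigma> u \<le> c \<Longrightarrow> \<tau> u \<le> c \<Longrightarrow>
      (\<And>i. i \<le> K \<Longrightarrow> \<bar>\<sigma> (a i) - \<tau> (a i)\<bar> < 1 / Suc K) \<Longrightarrow> \<forall>i\<in>I. \<bar>\<sigma> i - \<tau> i\<bar> < e"
proof -
  define b where "b = \<bar>c\<bar> + 1"
  have b: "b > 0" "c \<le> b" by (auto simp: b_def)
  \<comment> \<open>Replacing \<open>x\<close> by a sequence element within \<open>r\<close> costs
    at most e/3 for each of the two functionals; the last third is the precision along the
    sequence.\<close>
  define r where "r = e / (3 * b)"
  have r: "r > 0" using e b by (simp add: r_def)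
  have "\<forall>x. \<exists>n. r *\<^sub>R u - (x - a n) \<in> P \<and> r *\<^sub>R u + (x - a n) \<in> P" using dense[OF r] by blast
  then obtain n where n: "\<And>x. r *\<^sub>R u - (x - a (n x)) \<in> P" "\<And>x. r *\<^sub>R u + (x - a (n x)) \<in> P"
    by (metis (no_types, lifting))
  obtain K0 :: nat where K0: "1 / Suc K0 < e / 3"
    using reals_Archimedean[of "e / 3"] e by (auto simp: inverse_eq_divide)
  define K where "K = K0 + k + sum n I"
  have approx: "\<bar>\<sigma> x - \<sigma> (a (n x))\<bar> \<le> e / 3" if "\<sigma> \<in> Pdual" "\<sigma> u \<le> c" for \<sigma> x
  proof -
    have "\<bar>\<sigma> x - \<sigma> (a (n x))\<bar> \<le> r * \<sigma> u" using that(1) r n by (intro Pdual_diff_bound)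
    also have "\<dots> \<le> r * b" using that(2) r b by (intro mult_left_mono) auto
    also have "\<dots> = e / 3" using b by (simp add: r_def)
    finally show ?thesis .
  qed
  show thesis
  proof (rule that)
    show "k \<le> K" by (simp add: K_def)
    fix \<sigma> \<tau> assume \<sigma>\<tau>: "\<sigma> \<in> Pdual" "\<tau> \<in> Pdual" "\<sigma> u \<le> c" "\<tau> u \<le> c"
      and close: "\<And>i. i \<le> K \<Longrightarrow> \<bar>\<sigma> (a i) - \<tau> (a i)\<bar> < 1 / Suc K"
    show "\<forall>i\<in>I. \<bar>\<sigma> i - \<tau> i\<bar> < e"
    proof
      fix i assume i: "i \<in> I"
      have "n i \<le> sum n I" using member_le_sum[OF i _ I, of n] by simp
      then have "\<bar>\<sigma> (a (n i)) - \<tau> (a (n i))\<bar> < 1 / Suc K" by (intro close) (simp add: K_def)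
      also have "1 / real (Suc K) \<le> 1 / Suc K0" by (rule inverse_Suc_antimono) (simp add: K_def)
      finally show "\<bar>\<sigma> i - \<tau> i\<bar> < e"
        using K0 approx[OF \<sigma>\<tau>(1,3), of i] approx[OF \<sigma>\<tau>(2,4), of i] unfolding abs_le_iff abs_less_iff by linarith
    qed
  qed
qed

lemma CUp_dense_coordinates:
  assumes F: "F \<in> CUp" and I: "finite I" and e: "e > 0"
  obtains K where "K \<ge> k"
    "\<And>\<sigma> \<tau>. \<sigma> \<in> F \<Longrightarrow> \<tau> \<in> F \<Longrightarrow> (\<And>i. i \<le> K \<Longrightarrow> \<bar>\<sigma> (a i) - \<tau> (a i)\<bar> < 1 / Suc K)
      \<Longrightarrow> \<forall>i\<in>I. \<bar>\<sigma> i - \<tau> i\<bar> < e"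
proof -
  obtain c where c: "\<And>\<sigma>. \<sigma> \<in> F \<Longrightarrow> \<sigma> u \<le> c" using CUpD(5)[OF F] by blast
  obtain K where K: "K \<ge> k"
    "\<And>\<sigma> \<tau>. \<sigma> \<in> Pdual \<Longrightarrow> \<tau> \<in> Pdual \<Longrightarrow> \<sigma> u \<le> c \<Longrightarrow> \<tau> u \<le> c \<Longrightarrow>
      (\<And>i. i \<le> K \<Longrightarrow> \<bar>\<sigma> (a i) - \<tau> (a i)\<bar> < 1 / Suc K) \<Longrightarrow> \<forall>i\<in>I. \<bar>\<sigma> i - \<tau> i\<bar> < e"
    using dense_coordinates[OF I e, of k c] by blast
  show thesis
  proof (rule that[OF K(1)])
    fix \<sigma> \<tau> assume "\<sigma> \<in> F" "\<tau> \<in> F" and *: "\<And>i. i \<le> K \<Longrightarrow> \<bar>\<sigma> (a i) - \<tau> (a i)\<bar> < 1 / Suc K"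
    moreover have "F \<subseteq> Pdual" by (rule CUpD(4)[OF F])
    ultimately show "\<forall>i\<in>I. \<bar>\<sigma> i - \<tau> i\<bar> < e" using c by (intro K(2)) auto
  qed
qed

text \<open>The non-strict lower bound on the length makes this set compact. The length
  \<open>r\<close> is kept separate from \<open>k\<close> because the half scale 1/(2(k+1)) is used
  as well.\<close>

definition midpoints :: "nat \<Rightarrow> real \<Rightarrow> ('a \<Rightarrow> real) set \<Rightarrow> ('a \<Rightarrow> real) set" where
  "midpoints k r F = {\<lambda>x. (\<alpha> x + \<beta> x) / 2 | \<alpha> \<beta>. \<alpha> \<in> F \<and> \<beta> \<in> F \<and> (\<exists>i\<le>k. \<bar>\<alpha> (a i) - \<beta> (a i)\<bar> \<ge> r)}"

text \<open>A continuous image of a finite union of closed subsets of the compact square of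
  \<open>F\<close>.\<close>

lemma compact_midpoints:
  assumes F: "F \<in> CUp"
  shows "compact (midpoints k r F)"
proof -
  let ?S = "\<Union>i\<le>k. (F \<times> F) \<inter> {p. r \<le> \<bar>fst p (a i) - snd p (a i)\<bar>}"
  let ?m = "\<lambda>p x. (fst p x + snd p x) / (2::real)"
  have "compact ?S"
    using CUpD(6)[OF F]
    by (intro compact_UN compact_Int_closed compact_Times closed_Collect_le continuous_intros) auto
  moreover have "continuous_on ?S ?m" by (intro continuous_intros) auto
  ultimately have "compact (?m ` ?S)" by (rule compact_continuous_image[rotated])
  moreover have "?m ` ?S = midpoints k r F"
    unfolding midpoints_def by (force simp: image_iff)
  ultimately show ?thesis by simp
qed

lemma midpoints_mono: "k \<le> K \<Longrightarrow> midpoints k (1 / Suc k) F \<subseteq> midpoints K (1 / Suc K) F"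
proof
  fix \<tau> assume k: "k \<le> K" and "\<tau> \<in> midpoints k (1 / Suc k) F"
  then obtain \<alpha> \<beta> i where *: "\<tau> = (\<lambda>x. (\<alpha> x + \<beta> x) / 2)" "\<alpha> \<in> F" "\<beta> \<in> F" "i \<le> k"
    "1 / Suc k \<le> \<bar>\<alpha> (a i) - \<beta> (a i)\<bar>"
    unfolding midpoints_def by blast
  have "1 / real (Suc K) \<le> 1 / Suc k" using k by (rule inverse_Suc_antimono)
  then have "1 / Suc K \<le> \<bar>\<alpha> (a i) - \<beta> (a i)\<bar>" using *(5) by linarith
  moreover have "i \<le> K" using *(4) k by simp
  ultimately show "\<tau> \<in> midpoints K (1 / Suc K) F" unfolding midpoints_def using *(1-3) by blast
qed

lemma extreme_not_midpoint:
  assumes "\<tau> \<in> fextreme_points F" "r > 0"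
  shows "\<tau> \<notin> midpoints k r F"
proof
  assume "\<tau> \<in> midpoints k r F"
  then obtain \<alpha> \<beta> i where *: "\<tau> = (\<lambda>x. (\<alpha> x + \<beta> x) / 2)" "\<alpha> \<in> F" "\<beta> \<in> F" "r \<le> \<bar>\<alpha> (a i) - \<beta> (a i)\<bar>"
    unfolding midpoints_def by blast
  have "\<tau> = (\<lambda>A. (1/2) * \<alpha> A + (1 - 1/2) * \<beta> A)" using *(1) by (simp add: fun_eq_iff field_simps)
  moreover have "0 < (1/2 :: real) \<and> (1/2 :: real) < 1" by simp
  ultimately have "\<alpha> = \<beta>" using assms(1) *(2,3) unfolding fextreme_points_def by blast
  then show False using *(4) assms(2) by simp
qed

lemma CUp_eq_on_dense:
  assumes F: "F \<in> CUp" and \<alpha>\<beta>: "\<alpha> \<in> F" "\<beta> \<in> F" and eq: "\<And>n. \<alpha> (a n) = \<beta> (a n)"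
  shows "\<alpha> = \<beta>"
proof (rule ext, rule ccontr)
  fix x assume "\<alpha> x \<noteq> \<beta> x"
  then have pos: "\<bar>\<alpha> x - \<beta> x\<bar> > 0" by simp
  obtain K where "\<And>\<sigma> \<tau>. \<sigma> \<in> F \<Longrightarrow> \<tau> \<in> F \<Longrightarrow> (\<And>i. i \<le> K \<Longrightarrow> \<bar>\<sigma> (a i) - \<tau> (a i)\<bar> < 1 / Suc K)
      \<Longrightarrow> \<forall>i\<in>{x}. \<bar>\<sigma> i - \<tau> i\<bar> < \<bar>\<alpha> x - \<beta> x\<bar>"
    by (rule CUp_dense_coordinates[OF F, of "{x}" "\<bar>\<alpha> x - \<beta> x\<bar>" 0]) (use pos in auto)
  from this[OF \<alpha>\<beta>] show False using eq by simp
qed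

text \<open>A proper convex combination is also the midpoint of a nondegenerate subsegment, and
  distinct members of \<open>F\<close> differ somewhere along the dense sequence, so that some
  \<open>k\<close> detects the subsegment.\<close>

lemma fextreme_points_eq:
  assumes F: "F \<in> CUp"
  shows "fextreme_points F = F - (\<Union>k. midpoints k (1 / Suc k) F)"
proof (intro equalityI subsetI)
  fix \<tau> assume \<tau>: "\<tau> \<in> fextreme_points F"
  then have "\<tau> \<in> F" by (simp add: fextreme_points_def)
  moreover have "\<tau> \<notin> midpoints k (1 / Suc k) F" for k by (rule extreme_not_midpoint[OF \<tau>]) simp
  ultimately show "\<tau> \<in> F - (\<Union>k. midpoints k (1 / Suc k) F)" by blast
next
  fix \<tau> assume \<tau>: "\<tau> \<in> F - (\<Union>k. midpoints k (1 / Suc k) F)"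
  show "\<tau> \<in> fextreme_points F"
    unfolding fextreme_points_def
  proof (intro CollectI conjI ballI allI impI)
    show "\<tau> \<in> F" using \<tau> by simp
    fix \<sigma>1 \<sigma>2 and t :: real
    assume \<sigma>: "\<sigma>1 \<in> F" "\<sigma>2 \<in> F" and t: "0 < t \<and> t < 1 \<and> \<tau> = (\<lambda>A. t * \<sigma>1 A + (1 - t) * \<sigma>2 A)"
    \<comment> \<open>Half the length of the largest parameter interval inside [0, 1] that is
      centred at \<open>t\<close>.\<close>
    define s where "s = min t (1 - t)"
    define \<alpha> where "\<alpha> = (\<lambda>A. (t + s) * \<sigma>1 A + (1 - (t + s)) * \<sigma>2 A)"
    define \<beta> where "\<beta> = (\<lambda>A. (t - s) * \<sigma>1 A + (1 - (t - s)) * \<sigma>2 A)"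
    have s: "0 < s" "t + s \<le> 1" "0 \<le> t - s" using t by (auto simp: s_def)
    have \<alpha>\<beta>: "\<alpha> \<in> F" "\<beta> \<in> F"
      unfolding \<alpha>_def \<beta>_def using CUpD(2)[OF F] \<sigma> s t by (auto simp: fconvex_def)
    have mid: "\<tau> = (\<lambda>x. (\<alpha> x + \<beta> x) / 2)"
    proof
      fix x
      have "(\<alpha> x + \<beta> x) / 2 = t * \<sigma>1 x + (1 - t) * \<sigma>2 x"
        by (simp add: \<alpha>_def \<beta>_def algebra_simps add_divide_distrib diff_divide_distrib)
      then show "\<tau> x = (\<alpha> x + \<beta> x) / 2" using t by simp
    qed
    have "\<alpha> = \<beta>"
    proof (rule CUp_eq_on_dense[OF F \<alpha>\<beta>], rule ccontr)
      fix n assume "\<alpha> (a n) \<noteq> \<beta> (a n)"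
      then have "\<bar>\<alpha> (a n) - \<beta> (a n)\<bar> > 0" by simp
      then obtain m where m: "inverse (real (Suc m)) < \<bar>\<alpha> (a n) - \<beta> (a n)\<bar>" using reals_Archimedean by blast
      \<comment> \<open>The index must reach coordinate \<open>n\<close> and be fine enough for the
        threshold given by \<open>m\<close>.\<close>
      have "1 / real (Suc (max m n)) \<le> 1 / Suc m" by (rule inverse_Suc_antimono) simp
      also have "\<dots> \<le> \<bar>\<alpha> (a n) - \<beta> (a n)\<bar>" using m by (simp add: inverse_eq_divide)
      finally have "1 / real (Suc (max m n)) \<le> \<bar>\<alpha> (a n) - \<beta> (a n)\<bar>" .
      moreover have "n \<le> max m n" by simp
      ultimately have "\<tau> \<in> midpoints (max m n) (1 / real (Suc (max m n))) F"
        unfolding midpoints_def using \<alpha>\<beta> mid by blast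
      then show False using \<tau> by blast
    qed
    have "2 * s * \<sigma>1 x = 2 * s * \<sigma>2 x" for x
    proof -
      have "\<alpha> x = \<beta> x" using \<open>\<alpha> = \<beta>\<close> by simp
      then show ?thesis by (simp only: \<alpha>_def \<beta>_def) (simp add: algebra_simps)
    qed
    then show "\<sigma>1 = \<sigma>2" using s(1) by (auto simp: fun_eq_iff)
  qed
qed

text \<open>The slack \<open>e\<close> makes these conditions open.\<close>

definition almost_extremal :: "nat \<Rightarrow> ('a \<Rightarrow> real) set set" where
  "almost_extremal k = {F \<in> CUp. \<exists>E I e. finite E \<and> E \<subseteq> F \<and> finite I \<and> e > 0
    \<and> (\<forall>\<sigma>\<in>F. \<exists>\<tau>\<in>E. \<forall>i\<le>k. \<bar>\<sigma> (a i) - \<tau> (a i)\<bar> < 1 / Suc k - e)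
    \<and> (\<forall>\<tau>\<in>E. \<forall>\<alpha>\<in>F. \<forall>\<beta>\<in>F. (\<forall>i\<in>I. \<bar>(\<alpha> i + \<beta> i) / 2 - \<tau> i\<bar> < e)
        \<longrightarrow> (\<forall>i\<le>k. \<bar>\<alpha> (a i) - \<beta> (a i)\<bar> < 1 / Suc k - e))}"

lemma almost_extremal_E:
  assumes "F \<in> almost_extremal k"
  obtains E I e where "finite E" "E \<subseteq> F" "finite I" "e > 0"
    "\<And>\<sigma>. \<sigma> \<in> F \<Longrightarrow> \<exists>\<tau>\<in>E. \<forall>i\<le>k. \<bar>\<sigma> (a i) - \<tau> (a i)\<bar> < 1 / Suc k - e"
    "\<And>\<tau> \<alpha> \<beta> i. \<tau> \<in> E \<Longrightarrow> \<alpha> \<in> F \<Longrightarrow> \<beta> \<in> F \<Longrightarrow> \<forall>i\<in>I. \<bar>(\<alpha> i + \<beta> i) / 2 - \<tau> i\<bar> < e \<Longrightarrow> i \<le> k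
      \<Longrightarrow> \<bar>\<alpha> (a i) - \<beta> (a i)\<bar> < 1 / Suc k - e"
proof -
  from assms have "\<exists>E I e. finite E \<and> E \<subseteq> F \<and> finite I \<and> e > 0
    \<and> (\<forall>\<sigma>\<in>F. \<exists>\<tau>\<in>E. \<forall>i\<le>k. \<bar>\<sigma> (a i) - \<tau> (a i)\<bar> < 1 / Suc k - e)
    \<and> (\<forall>\<tau>\<in>E. \<forall>\<alpha>\<in>F. \<forall>\<beta>\<in>F. (\<forall>i\<in>I. \<bar>(\<alpha> i + \<beta> i) / 2 - \<tau> i\<bar> < e)
        \<longrightarrow> (\<forall>i\<le>k. \<bar>\<alpha> (a i) - \<beta> (a i)\<bar> < 1 / Suc k - e))"
    unfolding almost_extremal_def mem_Collect_eq by (rule conjunct2)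
  then show thesis
  proof (elim exE conjE)
    fix E I e
    assume "finite E" "E \<subseteq> F" "finite I" "e > 0"
      "\<forall>\<sigma>\<in>F. \<exists>\<tau>\<in>E. \<forall>i\<le>k. \<bar>\<sigma> (a i) - \<tau> (a i)\<bar> < 1 / Suc k - e"
      "\<forall>\<tau>\<in>E. \<forall>\<alpha>\<in>F. \<forall>\<beta>\<in>F. (\<forall>i\<in>I. \<bar>(\<alpha> i + \<beta> i) / 2 - \<tau> i\<bar> < e)
        \<longrightarrow> (\<forall>i\<le>k. \<bar>\<alpha> (a i) - \<beta> (a i)\<bar> < 1 / Suc k - e)"
    then show thesis by (intro that[of E I e]) simp_all
  qed
qed

text \<open>Extreme points avoid the closed set of midpoints of segments of half the permitted
  length, hence so do basic neighborhoods of them; as \<open>E\<close> is finite, one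
  \<open>I\<close> and one \<open>e\<close> serve all. The other half of the length is the room for
  the slack.\<close>

lemma almost_extremal_I:
  assumes G: "G \<in> CUp" and E: "finite E" "E \<subseteq> fextreme_points G"
    and net: "\<And>\<sigma>. \<sigma> \<in> G \<Longrightarrow> \<exists>\<tau>\<in>E. \<forall>i\<le>k. \<bar>\<sigma> (a i) - \<tau> (a i)\<bar> < 1 / (2 * real (Suc k))"
  shows "G \<in> almost_extremal k"
proof -
  define r where "r = 1 / (2 * real (Suc k))"
  have r: "r > 0" "1 / Suc k = 2 * r" by (simp_all add: r_def divide_simps)
  have op: "open (- midpoints k r G)"
    using compact_imp_closed_fun[OF compact_midpoints[OF G]] by (rule open_Compl)
  have "\<forall>\<tau>\<in>E. \<exists>p. finite (fst p) \<and> snd p > 0 \<and> (\<forall>g. (\<forall>i\<in>fst p. \<bar>g i - \<tau> i\<bar> < snd p) \<longrightarrow> g \<notin> midpoints k r G)"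
  proof
    fix \<tau> assume "\<tau> \<in> E"
    then have "\<tau> \<in> - midpoints k r G" using extreme_not_midpoint[OF _ r(1)] E(2) by blast
    then obtain I e where I: "finite I" "e > 0" "\<And>g. (\<And>i. i \<in> I \<Longrightarrow> \<bar>g i - \<tau> i\<bar> < e) \<Longrightarrow> g \<in> - midpoints k r G"
      by (rule open_fun_basis[OF op]) blast
    then show "\<exists>p. finite (fst p) \<and> snd p > 0 \<and> (\<forall>g. (\<forall>i\<in>fst p. \<bar>g i - \<tau> i\<bar> < snd p) \<longrightarrow> g \<notin> midpoints k r G)"
      by (intro exI[of _ "(I, e)"]) auto
  qed
  then obtain p where p: "\<And>\<tau>. \<tau> \<in> E \<Longrightarrow> finite (fst (p \<tau>))" "\<And>\<tau>. \<tau> \<in> E \<Longrightarrow> snd (p \<tau>) > 0"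
    "\<And>\<tau> g. \<tau> \<in> E \<Longrightarrow> \<forall>i\<in>fst (p \<tau>). \<bar>g i - \<tau> i\<bar> < snd (p \<tau>) \<Longrightarrow> g \<notin> midpoints k r G"
    unfolding bchoice_iff by blast
  define I where "I = (\<Union>\<tau>\<in>E. fst (p \<tau>))"
  define e where "e = Min (insert r ((\<lambda>\<tau>. snd (p \<tau>)) ` E))"
  have e: "e > 0" "e \<le> r" "\<And>\<tau>. \<tau> \<in> E \<Longrightarrow> e \<le> snd (p \<tau>)" using E(1) p(2) r(1) by (auto simp: e_def)
  show ?thesis
    unfolding almost_extremal_def
  proof (intro CollectI conjI exI ballI impI allI)
    show "G \<in> CUp" "finite E" "finite I" "e > 0" using G E p(1) e by (auto simp: I_def)
    show "E \<subseteq> G" using E(2) by (auto simp: fextreme_points_def)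
    fix \<sigma> assume "\<sigma> \<in> G"
    from net[OF this] obtain \<tau> where \<tau>: "\<tau> \<in> E" "\<And>i. i \<le> k \<Longrightarrow> \<bar>\<sigma> (a i) - \<tau> (a i)\<bar> < r"
      unfolding r_def by blast
    have "r \<le> 1 / Suc k - e" using e(2) r(2) by simp
    then have "\<bar>\<sigma> (a i) - \<tau> (a i)\<bar> < 1 / Suc k - e" if "i \<le> k" for i
      using \<tau>(2)[OF that] by linarith
    then show "\<exists>\<tau>\<in>E. \<forall>i\<le>k. \<bar>\<sigma> (a i) - \<tau> (a i)\<bar> < 1 / Suc k - e" using \<tau>(1) by blast
  next
    fix \<tau> \<alpha> \<beta> i
    assume \<tau>: "\<tau> \<in> E" and \<alpha>\<beta>: "\<alpha> \<in> G" "\<beta> \<in> G" and "\<forall>i\<in>I. \<bar>(\<alpha> i + \<beta> i) / 2 - \<tau> i\<bar> < e" and i: "i \<le> k"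
    then have "\<forall>i\<in>fst (p \<tau>). \<bar>(\<alpha> i + \<beta> i) / 2 - \<tau> i\<bar> < snd (p \<tau>)"
      using e(3)[OF \<tau>] \<tau> unfolding I_def by (auto intro: less_le_trans)
    then have "(\<lambda>x. (\<alpha> x + \<beta> x) / 2) \<notin> midpoints k r G" by (rule p(3)[OF \<tau>])
    then have "\<not> r \<le> \<bar>\<alpha> (a i) - \<beta> (a i)\<bar>" using \<alpha>\<beta> i unfolding midpoints_def by blast
    then show "\<bar>\<alpha> (a i) - \<beta> (a i)\<bar> < 1 / Suc k - e" using e(2) r(2) by linarith
  qed
qed

text \<open>The net is carried from \<open>F\<close> to a nearby \<open>G\<close>, and pairs in
  \<open>G\<close> are compared with partners in \<open>F\<close>, each move costing less than e/4.
  Two moves reduce the slack from \<open>e\<close> to e/2. For midpoints the budget is e/4 for the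
  pair, e/4 for the net point and e/2 from the hypothesis.\<close>

lemma openin_almost_extremal: "openin CUp_top (almost_extremal k)"
  unfolding openin_CUp_top_iff
proof (intro conjI ballI)
  show "almost_extremal k \<subseteq> CUp" by (auto simp: almost_extremal_def)
  fix F assume "F \<in> almost_extremal k"
  then have F: "F \<in> CUp" by (simp add: almost_extremal_def)
  from \<open>F \<in> almost_extremal k\<close> obtain E I e where E: "finite E" "E \<subseteq> F" and I: "finite I" and e: "e > 0"
    and net: "\<And>\<sigma>. \<sigma> \<in> F \<Longrightarrow> \<exists>\<tau>\<in>E. \<forall>i\<le>k. \<bar>\<sigma> (a i) - \<tau> (a i)\<bar> < 1 / Suc k - e"
    and short: "\<And>\<tau> \<alpha> \<beta> i. \<tau> \<in> E \<Longrightarrow> \<alpha> \<in> F \<Longrightarrow> \<beta> \<in> F \<Longrightarrow> \<forall>i\<in>I. \<bar>(\<alpha> i + \<beta> i) / 2 - \<tau> i\<bar> < e \<Longrightarrow> i \<le> k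
        \<Longrightarrow> \<bar>\<alpha> (a i) - \<beta> (a i)\<bar> < 1 / Suc k - e"
    by (rule almost_extremal_E) blast
  \<comment> \<open>The coordinates measuring net distances and segment lengths have to be preserved
    along with those of \<open>I\<close>.\<close>
  define I' where "I' = I \<union> a ` {..k}"
  have I': "finite I'" "I \<subseteq> I'" "\<And>i. i \<le> k \<Longrightarrow> a i \<in> I'" using I by (auto simp: I'_def)
  obtain J d where J: "finite J" "d > 0"
    "\<And>G. G \<in> CUp \<Longrightarrow> (\<And>x. x \<in> J \<Longrightarrow> \<bar>supp G x - supp F x\<bar> < d) \<Longrightarrow> hclose I' (e / 4) F G"
    by (rule supp_close_imp_hclose[OF F I'(1), of "e / 4"]) (use e in auto)
  have "G \<in> almost_extremal k" if G: "G \<in> CUp" and "\<forall>x\<in>J. \<bar>supp G x - supp F x\<bar> < d" for G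
  proof -
    have h: "hclose I' (e / 4) F G" using that by (intro J(3)) auto
    have FG: "\<exists>\<tau>\<in>G. \<forall>i\<in>I'. \<bar>\<sigma> i - \<tau> i\<bar> < e / 4" if "\<sigma> \<in> F" for \<sigma>
      using h that unfolding hclose_def by blast
    have GF: "\<exists>\<sigma>\<in>F. \<forall>i\<in>I'. \<bar>\<sigma> i - \<tau> i\<bar> < e / 4" if "\<tau> \<in> G" for \<tau>
      using h that unfolding hclose_def by blast
    have "\<forall>\<tau>\<in>E. \<exists>\<tau>'. \<tau>' \<in> G \<and> (\<forall>i\<in>I'. \<bar>\<tau> i - \<tau>' i\<bar> < e / 4)"
      using FG E(2) by blast
    then obtain g where g: "\<And>\<tau>. \<tau> \<in> E \<Longrightarrow> g \<tau> \<in> G"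
      "\<And>\<tau> i. \<tau> \<in> E \<Longrightarrow> i \<in> I' \<Longrightarrow> \<bar>\<tau> i - g \<tau> i\<bar> < e / 4"
      unfolding bchoice_iff by blast
    show "G \<in> almost_extremal k"
      unfolding almost_extremal_def
    proof (intro CollectI conjI exI ballI impI allI)
      show "G \<in> CUp" "finite (g ` E)" "g ` E \<subseteq> G" "finite I'" "e / 2 > 0" using G E(1) g(1) I' e by auto
      fix \<sigma>' assume "\<sigma>' \<in> G"
      then obtain \<sigma> where \<sigma>: "\<sigma> \<in> F" "\<forall>i\<in>I'. \<bar>\<sigma> i - \<sigma>' i\<bar> < e / 4" using GF by blast
      obtain \<tau> where \<tau>: "\<tau> \<in> E" "\<forall>i\<le>k. \<bar>\<sigma> (a i) - \<tau> (a i)\<bar> < 1 / Suc k - e" using net[OF \<sigma>(1)] by blast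
      have "\<bar>\<sigma>' (a i) - g \<tau> (a i)\<bar> < 1 / Suc k - e / 2" if "i \<le> k" for i
      proof -
        have "\<bar>\<sigma> (a i) - \<sigma>' (a i)\<bar> < e / 4" using \<sigma>(2) I'(3)[OF that] by blast
        moreover have "\<bar>\<tau> (a i) - g \<tau> (a i)\<bar> < e / 4" using g(2)[OF \<tau>(1) I'(3)[OF that]] .
        moreover have "\<bar>\<sigma> (a i) - \<tau> (a i)\<bar> < 1 / Suc k - e" using \<tau>(2) that by blast
        ultimately show ?thesis unfolding abs_less_iff by linarith
      qed
      then show "\<exists>\<tau>\<in>g ` E. \<forall>i\<le>k. \<bar>\<sigma>' (a i) - \<tau> (a i)\<bar> < 1 / Suc k - e / 2" using \<tau>(1) by blast
    next
      fix \<tau>' \<alpha>' \<beta>' i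
      assume \<tau>': "\<tau>' \<in> g ` E" and \<alpha>\<beta>': "\<alpha>' \<in> G" "\<beta>' \<in> G"
        and mid: "\<forall>i\<in>I'. \<bar>(\<alpha>' i + \<beta>' i) / 2 - \<tau>' i\<bar> < e / 2" and i: "i \<le> k"
      obtain \<tau> where \<tau>: "\<tau> \<in> E" "\<tau>' = g \<tau>" using \<tau>' by blast
      obtain \<alpha> where \<alpha>: "\<alpha> \<in> F" "\<forall>i\<in>I'. \<bar>\<alpha> i - \<alpha>' i\<bar> < e / 4" using GF[OF \<alpha>\<beta>'(1)] by blast
      obtain \<beta> where \<beta>: "\<beta> \<in> F" "\<forall>i\<in>I'. \<bar>\<beta> i - \<beta>' i\<bar> < e / 4" using GF[OF \<alpha>\<beta>'(2)] by blast
      have "\<bar>(\<alpha> j + \<beta> j) / 2 - \<tau> j\<bar> < e" if "j \<in> I" for j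
      proof -
        have j: "j \<in> I'" using that I'(2) by blast
        have "\<bar>\<alpha> j - \<alpha>' j\<bar> < e / 4" "\<bar>\<beta> j - \<beta>' j\<bar> < e / 4" "\<bar>(\<alpha>' j + \<beta>' j) / 2 - \<tau>' j\<bar> < e / 2"
          using \<alpha>(2) \<beta>(2) mid j by auto
        moreover have "\<bar>\<tau> j - \<tau>' j\<bar> < e / 4" using g(2)[OF \<tau>(1) j] \<tau>(2) by simp
        ultimately show ?thesis unfolding abs_less_iff add_divide_distrib by linarith
      qed
      then have "\<bar>\<alpha> (a i) - \<beta> (a i)\<bar> < 1 / Suc k - e" using \<tau>(1) \<alpha>(1) \<beta>(1) i by (intro short) auto
      moreover have "\<bar>\<alpha> (a i) - \<alpha>' (a i)\<bar> < e / 4" "\<bar>\<beta> (a i) - \<beta>' (a i)\<bar> < e / 4"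
        using \<alpha>(2) \<beta>(2) I'(3)[OF i] by auto
      ultimately show "\<bar>\<alpha>' (a i) - \<beta>' (a i)\<bar> < 1 / Suc k - e / 2" unfolding abs_less_iff by linarith
    qed
  qed
  then show "\<exists>J d. finite J \<and> d > 0 \<and> (\<forall>G\<in>CUp. (\<forall>x\<in>J. \<bar>supp G x - supp F x\<bar> < d) \<longrightarrow> G \<in> almost_extremal k)"
    using J(1,2) by blast
qed

text \<open>The centres may come from any \<open>S\<close> that already approximates
  \<open>F\<close>, for instance from the extreme points.\<close>

lemma finite_net:
  fixes F :: "('b \<Rightarrow> real) set"
  assumes F: "compact F" and I: "finite I" and e: "e > 0"
    and S: "\<And>\<sigma>. \<sigma> \<in> F \<Longrightarrow> \<exists>\<tau>\<in>S. \<forall>i\<in>I. \<bar>\<sigma> i - \<tau> i\<bar> < e"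
  obtains E where "finite E" "E \<subseteq> S" "\<And>\<sigma>. \<sigma> \<in> F \<Longrightarrow> \<exists>\<tau>\<in>E. \<forall>i\<in>I. \<bar>\<sigma> i - \<tau> i\<bar> < e"
proof -
  let ?B = "\<lambda>\<tau> :: 'b \<Rightarrow> real. {\<sigma>. \<forall>i\<in>I. \<bar>\<sigma> i - \<tau> i\<bar> < e}"
  have "F \<subseteq> (\<Union>\<tau>\<in>S. ?B \<tau>)" using S by blast
  then obtain E where "E \<subseteq> S" "finite E" "F \<subseteq> (\<Union>\<tau>\<in>E. ?B \<tau>)"
    using compactE_image[OF F, of S ?B] open_fun_box[OF I] by blast
  then show thesis by (intro that) blast+
qed

lemma Dp_subset_almost_extremal: "Dp \<subseteq> almost_extremal k"
proof
  fix F assume "F \<in> Dp"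
  then have F: "F \<in> CUp" and cl: "F = closure (fextreme_points F)" by (auto simp: Dp_def)
  have "\<exists>\<tau>\<in>fextreme_points F. \<forall>i\<in>a ` {..k}. \<bar>\<sigma> i - \<tau> i\<bar> < 1 / (2 * real (Suc k))" if "\<sigma> \<in> F" for \<sigma>
  proof -
    let ?V = "{g. \<forall>i\<in>a ` {..k}. \<bar>g i - \<sigma> i\<bar> < 1 / (2 * real (Suc k))}"
    have "open ?V" by (rule open_fun_box) simp
    moreover have "\<sigma> \<in> ?V" by simp
    ultimately have "?V \<inter> fextreme_points F \<noteq> {}"
      using that cl open_Int_closure_eq_empty by blast
    then obtain \<tau> where \<tau>: "\<tau> \<in> fextreme_points F" "\<forall>i\<in>a ` {..k}. \<bar>\<tau> i - \<sigma> i\<bar> < 1 / (2 * real (Suc k))"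
      by blast
    then show ?thesis unfolding abs_minus_commute[of "\<tau> _"] by blast
  qed
  then obtain E where E: "finite E" "E \<subseteq> fextreme_points F"
    "\<And>\<sigma>. \<sigma> \<in> F \<Longrightarrow> \<exists>\<tau>\<in>E. \<forall>i\<in>a ` {..k}. \<bar>\<sigma> i - \<tau> i\<bar> < 1 / (2 * real (Suc k))"
    using finite_net[OF CUpD(6)[OF F], of "a ` {..k}" "1 / (2 * real (Suc k))" "fextreme_points F"] by auto
  show "F \<in> almost_extremal k"
  proof (rule almost_extremal_I[OF F E(1,2)])
    fix \<sigma> assume "\<sigma> \<in> F"
    from E(3)[OF this] show "\<exists>\<tau>\<in>E. \<forall>i\<le>k. \<bar>\<sigma> (a i) - \<tau> (a i)\<bar> < 1 / (2 * real (Suc k))" by blast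
  qed
qed

text \<open>Baire's theorem in the compact set \<open>F\<close>. To meet a given neighborhood off
  the midpoints of index \<open>k\<close>, one passes to a finer \<open>K\<close>: a net point for
  \<open>K\<close> lies in the neighborhood and is no midpoint of index \<open>K\<close>, hence none
  of index \<open>k\<close>.\<close>

lemma Inter_almost_extremal_subset_Dp: "(\<Inter>k. almost_extremal k) \<subseteq> Dp"
proof
  fix F assume FQ: "F \<in> (\<Inter>k. almost_extremal k)"
  then have F: "F \<in> CUp" by (auto simp: almost_extremal_def)
  define \<G> where "\<G> = range (\<lambda>k. F - midpoints k (1 / Suc k) F)"
  have comp: "compact_space (top_of_set F)"
    using CUpD(6)[OF F] by (simp add: compact_space_subtopology)
  have "top_of_set F closure_of \<Inter>\<G> = topspace (top_of_set F)"
  proof (rule Baire_category)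
    have "locally_compact_space (top_of_set F)" using comp by (rule compact_imp_locally_compact_space)
    then show "completely_metrizable_space (top_of_set F) \<or> locally_compact_space (top_of_set F) \<and> regular_space (top_of_set F)"
      using locally_compact_Hausdorff_imp_regular_space Hausdorff_fun by blast
    show "countable \<G>" by (simp add: \<G>_def)
    fix T assume "T \<in> \<G>"
    then obtain k where T: "T = F - midpoints k (1 / Suc k) F" by (auto simp: \<G>_def)
    have "openin (top_of_set F) (F \<inter> - midpoints k (1 / Suc k) F)"
      using compact_imp_closed_fun[OF compact_midpoints[OF F]] by (intro openin_open_Int open_Compl)
    then have op: "openin (top_of_set F) T" by (simp add: T Diff_eq)
    have "F \<subseteq> closure T"
    proof
      fix \<sigma> assume \<sigma>: "\<sigma> \<in> F"
      show "\<sigma> \<in> closure T"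
        unfolding closure_iff_nhds_not_empty
      proof (intro allI impI)
        fix A V assume V: "V \<subseteq> A" "open V" "\<sigma> \<in> V"
        obtain I e where I: "finite I" "e > 0" "\<And>g. (\<And>i. i \<in> I \<Longrightarrow> \<bar>g i - \<sigma> i\<bar> < e) \<Longrightarrow> g \<in> V"
          by (rule open_fun_basis[OF V(2,3)]) blast
        obtain K where K: "K \<ge> k"
          "\<And>\<sigma> \<tau>. \<sigma> \<in> F \<Longrightarrow> \<tau> \<in> F \<Longrightarrow> (\<And>i. i \<le> K \<Longrightarrow> \<bar>\<sigma> (a i) - \<tau> (a i)\<bar> < 1 / Suc K)
            \<Longrightarrow> \<forall>i\<in>I. \<bar>\<sigma> i - \<tau> i\<bar> < e"
          by (rule CUp_dense_coordinates[OF F I(1,2), of k]) blast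
        have "F \<in> almost_extremal K" using FQ by blast
        then obtain E I' e' where E: "finite E" "E \<subseteq> F" "finite I'" "e' > 0"
          "\<And>\<sigma>. \<sigma> \<in> F \<Longrightarrow> \<exists>\<tau>\<in>E. \<forall>i\<le>K. \<bar>\<sigma> (a i) - \<tau> (a i)\<bar> < 1 / Suc K - e'"
          "\<And>\<tau> \<alpha> \<beta> i. \<tau> \<in> E \<Longrightarrow> \<alpha> \<in> F \<Longrightarrow> \<beta> \<in> F \<Longrightarrow> \<forall>i\<in>I'. \<bar>(\<alpha> i + \<beta> i) / 2 - \<tau> i\<bar> < e' \<Longrightarrow> i \<le> K
            \<Longrightarrow> \<bar>\<alpha> (a i) - \<beta> (a i)\<bar> < 1 / Suc K - e'"
          by (rule almost_extremal_E) blast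
        obtain \<tau> where \<tau>: "\<tau> \<in> E" "\<And>i. i \<le> K \<Longrightarrow> \<bar>\<sigma> (a i) - \<tau> (a i)\<bar> < 1 / Suc K - e'" using E(5)[OF \<sigma>] by blast
        have "\<tau> \<notin> midpoints K (1 / Suc K) F"
        proof
          assume "\<tau> \<in> midpoints K (1 / Suc K) F"
          then obtain \<alpha> \<beta> i where *: "\<tau> = (\<lambda>x. (\<alpha> x + \<beta> x) / 2)" "\<alpha> \<in> F" "\<beta> \<in> F" "i \<le> K"
            "1 / Suc K \<le> \<bar>\<alpha> (a i) - \<beta> (a i)\<bar>"
            unfolding midpoints_def by blast
          \<comment> \<open>An exact midpoint satisfies the closeness hypothesis with difference 0,
            whatever \<open>I'\<close> is.\<close>
          have "\<bar>\<alpha> (a i) - \<beta> (a i)\<bar> < 1 / Suc K - e'"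
            using *(1) E(4) by (intro E(6)[OF \<tau>(1) *(2,3) _ *(4)]) simp
          then show False using *(5) E(4) by linarith
        qed
        then have "\<tau> \<notin> midpoints k (1 / Suc k) F" using midpoints_mono[OF K(1)] by blast
        then have "\<tau> \<in> T" using \<tau>(1) E(2) unfolding T by blast
        moreover have "\<tau> \<in> V"
        proof (rule I(3))
          have "\<bar>\<sigma> (a i) - \<tau> (a i)\<bar> < 1 / Suc K" if "i \<le> K" for i using \<tau>(2)[OF that] E(4) by linarith
          then have "\<forall>i\<in>I. \<bar>\<sigma> i - \<tau> i\<bar> < e" using \<tau>(1) E(2) by (intro K(2)[OF \<sigma>]) auto
          then show "\<bar>\<tau> i - \<sigma> i\<bar> < e" if "i \<in> I" for i using that by (simp add: abs_minus_commute)
        qed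
        ultimately show "T \<inter> A \<noteq> {}" using V(1) by blast
      qed
    qed
    moreover have "T \<subseteq> F" by (auto simp: T)
    ultimately show "openin (top_of_set F) T \<and> top_of_set F closure_of T = topspace (top_of_set F)"
      using op by (simp add: closure_of_subtopology inf.absorb2 inf.absorb1)
  qed
  moreover have "\<Inter>\<G> = fextreme_points F" unfolding \<G>_def fextreme_points_eq[OF F] by auto
  ultimately have "F \<inter> closure (F \<inter> fextreme_points F) = F" by (simp add: closure_of_subtopology)
  moreover have sub: "fextreme_points F \<subseteq> F" by (auto simp: fextreme_points_def)
  ultimately have "F \<subseteq> closure (fextreme_points F)" by (simp add: inf.absorb2 inf.orderI) 
  moreover have "closure (fextreme_points F) \<subseteq> F" using sub CUpD(3)[OF F] by (rule closure_minimal)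
  ultimately show "F \<in> Dp" unfolding Dp_def using F by blast
qed

lemma Dp_eq: "Dp = (\<Inter>k. almost_extremal k)"
  using Dp_subset_almost_extremal Inter_almost_extremal_subset_Dp by blast

section \<open>Approximation by simplices\<close>

text \<open>The functional \<open>p\<close> is the one-sided gauge of the order unit. Linear
  functionals below it are positive because \<open>p (- x) \<le> 0\<close> on the cone. If all
  positive functionals vanished at \<open>y\<close>, attained Hahn-Banach extensions would give
  \<open>p y = p (- y) = 0\<close>, and \<open>y\<close> would be infinitesimal.\<close>

lemma Pdual_separates:
  assumes y: "y \<noteq> 0"
  shows "\<exists>\<tau>\<in>Pdual. \<tau> y \<noteq> 0"
proof (rule ccontr)
  assume "\<not> (\<exists>\<tau>\<in>Pdual. \<tau> y \<noteq> 0)"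
  then have vanish: "\<And>\<tau>. \<tau> \<in> Pdual \<Longrightarrow> \<tau> y = 0" by blast
  define S where "S x = {t. t \<ge> 0 \<and> t *\<^sub>R u - x \<in> P}" for x
  define p where "p x = Inf (S x)" for x
  have ne: "S x \<noteq> {}" for x using absorbing[of x] by (auto simp: S_def intro: less_imp_le)
  have bdd: "bdd_below (S x)" for x by (rule bdd_belowI[of _ 0]) (simp add: S_def)
  have le: "p x \<le> t" if "t \<in> S x" for x t unfolding p_def using that bdd by (rule cInf_lower)
  have gr: "m \<le> p x" if "\<And>t. t \<in> S x \<Longrightarrow> m \<le> t" for x m
    unfolding p_def using ne that by (rule cInf_greatest)
  have nonneg: "p x \<ge> 0" for x by (rule gr) (simp add: S_def)
  have p: "sublinear p"
  proof (rule sublinearI)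
    fix x z
    have "p (x + z) \<le> s + t" if "s \<in> S x" "t \<in> S z" for s t
    proof (rule le)
      have "(s *\<^sub>R u - x) + (t *\<^sub>R u - z) \<in> P" using that by (intro cone_add) (auto simp: S_def)
      then show "s + t \<in> S (x + z)" using that by (simp add: S_def algebra_simps)
    qed
    then have "p (x + z) - t \<le> p x" if "t \<in> S z" for t
      using that by (intro gr) (simp add: diff_le_eq)
    then have "p (x + z) - p x \<le> t" if "t \<in> S z" for t using that by (simp add: diff_le_eq add.commute)
    then have "p (x + z) - p x \<le> p z" by (rule gr)
    then show "p (x + z) \<le> p x + p z" by simp
  next
    have "p 0 \<le> 0 + t" if "t > 0" for t
      using that cone_scale[OF that unit] by (intro le) (simp add: S_def)
    then have "p 0 \<le> 0" by (rule field_le_epsilon)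
    then show "p 0 = 0" using nonneg[of 0] by simp
  next
    fix c :: real and x assume c: "c > 0"
    have "p (c *\<^sub>R x) / c \<le> p x"
    proof (rule gr)
      fix t assume t: "t \<in> S x"
      then have "c *\<^sub>R (t *\<^sub>R u - x) \<in> P" using c by (intro cone_scale) (auto simp: S_def)
      then have "c * t \<in> S (c *\<^sub>R x)" using t c by (simp add: S_def algebra_simps)
      then have "p (c *\<^sub>R x) \<le> c * t" by (rule le)
      then show "p (c *\<^sub>R x) / c \<le> t" using c by (simp add: field_simps)
    qed
    then show "p (c *\<^sub>R x) \<le> c * p x" using c by (simp add: field_simps)
  qed
  have "p z = 0" if z: "z = y \<or> z = - y" for z
  proof -
    obtain f where f: "linear f" "\<And>x. f x \<le> p x" "f z = p z"
      by (rule hahn_banach_attained[OF p, where y = z]) blast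
    have "f x \<ge> 0" if "x \<in> P" for x
    proof -
      have "p (- x) \<le> 0" using that by (intro le) (simp add: S_def)
      then show ?thesis using f(2)[of "- x"] linear_neg[OF f(1), of x] by simp
    qed
    then have "f y = 0" using f(1) by (intro vanish) (simp add: Pdual_def)
    then show ?thesis using z f(3) linear_neg[OF f(1), of y] by auto
  qed
  then have p0: "p y = 0" "p (- y) = 0" by auto
  \<comment> \<open>The infimum need not be attained, but some \<open>s\<close> below
    \<open>t\<close> is admissible and can be raised to \<open>t\<close>.\<close>
  have small: "t *\<^sub>R u - z \<in> P" if t: "t > 0" and z: "p z = 0" for t z
  proof -
    have "Inf (S z) < t" using t z unfolding p_def by simp
    then obtain s where "s \<in> S z" "s < t" using cInf_lessD[OF ne] by blast
    then show ?thesis by (intro unit_mono[of s z t]) (auto simp: S_def)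
  qed
  have "y = 0"
    using small[OF _ p0(1)] small[OF _ p0(2)] by (intro infinitesimal) simp
  then show False using y by simp
qed

text \<open>Each functional lowers the dimension by at most one: if it is nonzero at
  \<open>z\<close> in the previous kernel, that kernel is spanned by \<open>z\<close> together with
  the new one.\<close>

lemma common_kernel_infinite_dimensional:
  fixes E :: "('a \<Rightarrow> real) set"
  assumes "finite E" "\<And>e. e \<in> E \<Longrightarrow> linear e"
  shows "finite B \<Longrightarrow> \<not> {y. \<forall>e\<in>E. e y = 0} \<subseteq> span B"
  using assms
proof (induction E arbitrary: B rule: finite_induct)
  case empty
  then show ?case using infinite_dimensional[of B] by auto
next
  case (insert e E)
  let ?L = "{y. \<forall>e\<in>E. e y = 0}"
  have IH: "\<not> ?L \<subseteq> span B" if "finite B" for B using insert.IH that insert.prems(2) by blast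
  have e: "linear e" and E: "\<And>f. f \<in> E \<Longrightarrow> linear f" using insert.prems(2) by auto
  show ?case
  proof
    assume sub: "{y. \<forall>f\<in>insert e E. f y = 0} \<subseteq> span B"
    show False
    proof (cases "\<exists>z\<in>?L. e z \<noteq> 0")
      case True
      then obtain z where z: "z \<in> ?L" "e z \<noteq> 0" by blast
      have "?L \<subseteq> span (insert z B)"
      proof
        fix x assume x: "x \<in> ?L"
        define w where "w = x - (e x / e z) *\<^sub>R z"
        have "e w = 0" using z(2) by (simp add: w_def linear_diff[OF e] linear_scale[OF e])
        moreover have "f w = 0" if "f \<in> E" for f
        proof -
          have "f x = 0" "f z = 0" using x z(1) that by auto
          then show ?thesis by (simp add: w_def linear_diff[OF E[OF that]] linear_scale[OF E[OF that]])
        qed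
        ultimately have "w \<in> span B" using sub by auto
        then have "w + (e x / e z) *\<^sub>R z \<in> span (insert z B)"
          by (intro span_add span_scale) (auto intro: span_base span_mono[THEN subsetD])
        then show "x \<in> span (insert z B)" by (simp add: w_def)
      qed
      then show False using IH[of "insert z B"] insert.prems(1) by simp
    next
      case False
      then have "?L \<subseteq> span B" using sub by auto
      then show False using IH insert.prems(1) by blast
    qed
  qed
qed

lemma common_kernel_nonzero:
  fixes E :: "('a \<Rightarrow> real) set"
  assumes "finite E" "\<And>e. e \<in> E \<Longrightarrow> linear e"
  obtains y where "y \<noteq> 0" "\<And>e. e \<in> E \<Longrightarrow> e y = 0"
proof -
  have "\<not> {y. \<forall>e\<in>E. e y = 0} \<subseteq> span {}"
    using assms by (intro common_kernel_infinite_dimensional) auto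
  then show thesis using that by auto
qed

section \<open>Cones over convex sets\<close>

lemma Pdual_convex:
  assumes "\<sigma> \<in> Pdual" "\<tau> \<in> Pdual" "0 \<le> s" "0 \<le> t"
  shows "(\<lambda>x. s * \<sigma> x + t * \<tau> x) \<in> Pdual"
  using assms by (auto simp: Pdual_def linear_iff algebra_simps)

text \<open>For nonempty convex \<open>G\<close> this is the convex hull of \<open>G\<close> and the
  apex, written as a union of segments so that it is the continuous image of a compact
  product.\<close>

definition cone_over :: "('a \<Rightarrow> real) \<Rightarrow> ('a \<Rightarrow> real) set \<Rightarrow> ('a \<Rightarrow> real) set" where
  "cone_over \<nu> G = (\<lambda>(t, g) x. (1 - t) * g x + t * \<nu> x) ` ({0..1} \<times> G)"

lemma cone_overE:
  assumes "\<sigma> \<in> cone_over \<nu> G"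
  obtains t g where "0 \<le> t" "t \<le> 1" "g \<in> G" "\<sigma> = (\<lambda>x. (1 - t) * g x + t * \<nu> x)"
  using assms by (auto simp: cone_over_def)

lemma cone_overI:
  "0 \<le> t \<Longrightarrow> t \<le> 1 \<Longrightarrow> g \<in> G \<Longrightarrow> (\<lambda>x. (1 - t) * g x + t * \<nu> x) \<in> cone_over \<nu> G"
  by (force simp: cone_over_def)

lemma cone_over_base: "G \<subseteq> cone_over \<nu> G"
  using cone_overI[of 0 _ G \<nu>] by auto

lemma cone_over_apex: "G \<noteq> {} \<Longrightarrow> \<nu> \<in> cone_over \<nu> G"
  using cone_overI[of 1 _ G \<nu>] by auto

text \<open>The total weight \<open>p + q\<close> on the base is regrouped onto one point of
  \<open>G\<close>; if it is 0, only the apex remains.\<close>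

lemma fconvex_cone_over:
  assumes G: "fconvex G"
  shows "fconvex (cone_over \<nu> G)"
  unfolding fconvex_def
proof (intro ballI allI impI)
  fix \<sigma> \<tau> and s :: real
  assume "\<sigma> \<in> cone_over \<nu> G" "\<tau> \<in> cone_over \<nu> G" and s: "0 \<le> s \<and> s \<le> 1"
  obtain t1 g1 where 1: "0 \<le> t1" "t1 \<le> 1" "g1 \<in> G" "\<sigma> = (\<lambda>x. (1 - t1) * g1 x + t1 * \<nu> x)"
    using \<open>\<sigma> \<in> cone_over \<nu> G\<close> by (rule cone_overE)
  obtain t2 g2 where 2: "0 \<le> t2" "t2 \<le> 1" "g2 \<in> G" "\<tau> = (\<lambda>x. (1 - t2) * g2 x + t2 * \<nu> x)"
    using \<open>\<tau> \<in> cone_over \<nu> G\<close> by (rule cone_overE)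
  define p where "p = s * (1 - t1)"
  define q where "q = (1 - s) * (1 - t2)"
  define T where "T = s * t1 + (1 - s) * t2"
  have pq: "p \<ge> 0" "q \<ge> 0" "1 - T = p + q" "T \<ge> 0"
    using s 1(1,2) 2(1,2) by (simp_all add: p_def q_def T_def) (simp add: algebra_simps)
  have eq: "s * \<sigma> x + (1 - s) * \<tau> x = p * g1 x + q * g2 x + T * \<nu> x" for x
    by (simp add: 1(4) 2(4) p_def q_def T_def algebra_simps)
  show "(\<lambda>A. s * \<sigma> A + (1 - s) * \<tau> A) \<in> cone_over \<nu> G"
  proof (cases "p + q = 0")
    case True
    then have "p = 0" "q = 0" "T = 1" using pq by auto
    then have "(\<lambda>A. s * \<sigma> A + (1 - s) * \<tau> A) = \<nu>" by (simp add: eq)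
    then show ?thesis using cone_over_apex[of G \<nu>] 1(3) by auto
  next
    case False
    then have pos: "p + q > 0" using pq by linarith
    define g where "g = (\<lambda>A. p / (p + q) * g1 A + (1 - p / (p + q)) * g2 A)"
    have "p / (p + q) \<le> 1" "0 \<le> p / (p + q)" using pq(1,2) pos by auto
    then have "g \<in> G" unfolding g_def using G 1(3) 2(3) unfolding fconvex_def by blast
    then have "(\<lambda>x. (1 - T) * g x + T * \<nu> x) \<in> cone_over \<nu> G" using pq by (intro cone_overI) auto
    moreover have "(1 - T) * g x = p * g1 x + q * g2 x" for x
    proof -
      have "1 - p / (p + q) = q / (p + q)" using pos by (simp add: field_simps)
      then show ?thesis using pos unfolding g_def pq(3) by (simp add: distrib_left)
    qed
    ultimately show ?thesis by (simp add: eq)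
  qed
qed

lemma compact_cone_over:
  assumes "compact G"
  shows "compact (cone_over \<nu> G)"
  unfolding cone_over_def
proof (rule compact_continuous_image)
  show "compact ({0..1::real} \<times> G)" using assms by (intro compact_Times) auto
  show "continuous_on ({0..1} \<times> G) (\<lambda>(t, g) x. (1 - t) * g x + t * \<nu> x)"
    unfolding case_prod_beta by (intro continuous_intros)
qed

lemma cone_over_CUp:
  assumes G: "G \<in> CUp" and \<nu>: "\<nu> \<in> Pdual"
  shows "cone_over \<nu> G \<in> CUp"
  unfolding CUp_def
proof (intro CollectI conjI)
  show "cone_over \<nu> G \<noteq> {}" using cone_over_apex CUpD(1)[OF G] by blast
  show "fconvex (cone_over \<nu> G)" using CUpD(2)[OF G] by (rule fconvex_cone_over)
  show "closed (cone_over \<nu> G)" using compact_cone_over[OF CUpD(6)[OF G]] by (rule compact_imp_closed_fun)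
  show "cone_over \<nu> G \<subseteq> Pdual"
    using CUpD(4)[OF G] \<nu> by (auto elim!: cone_overE intro!: Pdual_convex)
  obtain c where c: "\<And>\<sigma>. \<sigma> \<in> G \<Longrightarrow> \<sigma> u \<le> c" using CUpD(5)[OF G] by blast
  have "\<sigma> u \<le> max c (\<nu> u)" if "\<sigma> \<in> cone_over \<nu> G" for \<sigma>
  proof -
    obtain t g where g: "0 \<le> t" "t \<le> 1" "g \<in> G" "\<sigma> = (\<lambda>x. (1 - t) * g x + t * \<nu> x)"
      using \<open>\<sigma> \<in> cone_over \<nu> G\<close> by (rule cone_overE)
    have "\<sigma> u = (1 - t) * g u + t * \<nu> u" using g(4) by simp
    also have "\<dots> \<le> (1 - t) * max c (\<nu> u) + t * max c (\<nu> u)"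
      using g c[OF g(3)] by (intro add_mono mult_left_mono) auto
    finally show ?thesis by (simp add: algebra_simps)
  qed
  then show "\<exists>c. \<forall>\<sigma>\<in>cone_over \<nu> G. \<sigma> u \<le> c" by blast
qed

text \<open>The vector \<open>y\<close> exhibits both \<open>\<nu>\<close> and \<open>G\<close> as faces of the cone over \<open>G\<close>.\<close>

lemma cone_over_extreme:
  assumes G: "G \<noteq> {}" "\<And>g. g \<in> G \<Longrightarrow> g y = 0" and \<nu>: "\<nu> y > 0"
  shows "insert \<nu> (fextreme_points G) \<subseteq> fextreme_points (cone_over \<nu> G)"
proof -
  \<comment> \<open>Evaluation at \<open>y\<close>, divided by \<open>\<nu> y\<close>, recovers the
    cone parameter and is affine. The apex and the base are the levels 1 and 0, the extreme values
    of this parameter, so both ends of a segment through such a point lie on the same level.\<close>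
  have level: "\<exists>t1 t2 g1 g2. 0 \<le> t1 \<and> t1 \<le> 1 \<and> 0 \<le> t2 \<and> t2 \<le> 1 \<and> g1 \<in> G \<and> g2 \<in> G
      \<and> \<sigma>1 = (\<lambda>x. (1 - t1) * g1 x + t1 * \<nu> x) \<and> \<sigma>2 = (\<lambda>x. (1 - t2) * g2 x + t2 * \<nu> x)
      \<and> \<sigma> y / \<nu> y = s * t1 + (1 - s) * t2"
    if \<sigma>: "\<sigma>1 \<in> cone_over \<nu> G" "\<sigma>2 \<in> cone_over \<nu> G" "\<sigma> = (\<lambda>A. s * \<sigma>1 A + (1 - s) * \<sigma>2 A)" for \<sigma> \<sigma>1 \<sigma>2 s
  proof -
    obtain t1 g1 where 1: "0 \<le> t1" "t1 \<le> 1" "g1 \<in> G" "\<sigma>1 = (\<lambda>x. (1 - t1) * g1 x + t1 * \<nu> x)"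
      using \<sigma>(1) by (rule cone_overE)
    obtain t2 g2 where 2: "0 \<le> t2" "t2 \<le> 1" "g2 \<in> G" "\<sigma>2 = (\<lambda>x. (1 - t2) * g2 x + t2 * \<nu> x)"
      using \<sigma>(2) by (rule cone_overE)
    have "\<sigma> y = (s * t1 + (1 - s) * t2) * \<nu> y"
      using G(2)[OF 1(3)] G(2)[OF 2(3)] by (simp add: \<sigma>(3) 1(4) 2(4) algebra_simps)
    then have "\<sigma> y / \<nu> y = s * t1 + (1 - s) * t2" using \<nu> by simp
    then show ?thesis using 1 2 by blast
  qed
  have "\<nu> \<in> fextreme_points (cone_over \<nu> G)"
    unfolding fextreme_points_def
  proof (intro CollectI conjI ballI allI impI)
    show "\<nu> \<in> cone_over \<nu> G" using G(1) by (rule cone_over_apex)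
    fix \<sigma>1 \<sigma>2 and s :: real
    assume \<sigma>: "\<sigma>1 \<in> cone_over \<nu> G" "\<sigma>2 \<in> cone_over \<nu> G"
      and s: "0 < s \<and> s < 1 \<and> \<nu> = (\<lambda>A. s * \<sigma>1 A + (1 - s) * \<sigma>2 A)"
    obtain t1 t2 g1 g2 where t: "t1 \<le> 1" "t2 \<le> 1"
      "\<sigma>1 = (\<lambda>x. (1 - t1) * g1 x + t1 * \<nu> x)" "\<sigma>2 = (\<lambda>x. (1 - t2) * g2 x + t2 * \<nu> x)"
      "\<nu> y / \<nu> y = s * t1 + (1 - s) * t2"
      using level[OF \<sigma> conjunct2[OF conjunct2[OF s]]] by blast
    have "s * (1 - t1) + (1 - s) * (1 - t2) = 0" using t(5) \<nu> by (simp add: algebra_simps)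
    moreover have "s * (1 - t1) \<ge> 0" "(1 - s) * (1 - t2) \<ge> 0" using t(1,2) s by auto
    ultimately have "s * (1 - t1) = 0" "(1 - s) * (1 - t2) = 0" by linarith+
    then have "t1 = 1" "t2 = 1" using s by auto
    then show "\<sigma>1 = \<sigma>2" using t(3,4) by simp
  qed
  moreover have "\<rho> \<in> fextreme_points (cone_over \<nu> G)" if \<rho>: "\<rho> \<in> fextreme_points G" for \<rho>
    unfolding fextreme_points_def
  proof (intro CollectI conjI ballI allI impI)
    have \<rho>G: "\<rho> \<in> G" using \<rho> by (simp add: fextreme_points_def)
    then show "\<rho> \<in> cone_over \<nu> G" using cone_over_base by blast
    fix \<sigma>1 \<sigma>2 and s :: real
    assume \<sigma>: "\<sigma>1 \<in> cone_over \<nu> G" "\<sigma>2 \<in> cone_over \<nu> G"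
      and s: "0 < s \<and> s < 1 \<and> \<rho> = (\<lambda>A. s * \<sigma>1 A + (1 - s) * \<sigma>2 A)"
    obtain t1 t2 g1 g2 where t: "0 \<le> t1" "0 \<le> t2" "g1 \<in> G" "g2 \<in> G"
      "\<sigma>1 = (\<lambda>x. (1 - t1) * g1 x + t1 * \<nu> x)" "\<sigma>2 = (\<lambda>x. (1 - t2) * g2 x + t2 * \<nu> x)"
      "\<rho> y / \<nu> y = s * t1 + (1 - s) * t2"
      using level[OF \<sigma> conjunct2[OF conjunct2[OF s]]] by blast
    have "s * t1 + (1 - s) * t2 = 0" using t(7) G(2)[OF \<rho>G] by simp
    moreover have "s * t1 \<ge> 0" "(1 - s) * t2 \<ge> 0" using t(1,2) s by auto
    ultimately have "s * t1 = 0" "(1 - s) * t2 = 0" by linarith+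
    then have "t1 = 0" "t2 = 0" using s by auto
    then have "\<sigma>1 = g1" "\<sigma>2 = g2" using t(5,6) by auto
    then have "\<sigma>1 \<in> G" "\<sigma>2 \<in> G" using t(3,4) by auto
    then show "\<sigma>1 = \<sigma>2" using \<rho> s unfolding fextreme_points_def by blast
  qed
  ultimately show ?thesis by blast
qed

text \<open>The last conjunct is the invariant that drives the induction: it says through kernels
  that \<open>E\<close> spans \<open>G\<close>. A vector killed by the finitely many vertices then
  kills all of \<open>G\<close>, as \<open>cone_over_extreme\<close> requires of its base.\<close>

lemma simplex_approximation:
  assumes F: "F \<in> CUp" and I: "finite I" and e: "e > 0" and S: "finite S" "S \<noteq> {}" "S \<subseteq> F"
  shows "\<exists>G E. G \<in> CUp \<and> finite E \<and> E \<subseteq> fextreme_points G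
    \<and> (\<forall>\<sigma>\<in>S. \<exists>\<tau>\<in>E. \<forall>i\<in>I. \<bar>\<sigma> i - \<tau> i\<bar> < e) \<and> (\<forall>\<tau>\<in>G. \<exists>\<sigma>\<in>F. \<forall>i\<in>I. \<bar>\<sigma> i - \<tau> i\<bar> < e)
    \<and> (\<forall>y. (\<forall>\<tau>\<in>E. \<tau> y = 0) \<longrightarrow> (\<forall>\<tau>\<in>G. \<tau> y = 0))"
  using S
proof (induction S rule: finite_ne_induct)
  case (singleton \<sigma>)
  have "closed {\<sigma>}"
    using compact_imp_closed_fun[of "{\<sigma>}"] by simp
  moreover have "fconvex {\<sigma>}" by (auto simp: fconvex_def algebra_simps)
  ultimately have "{\<sigma>} \<in> CUp" using singleton CUpD(4)[OF F] by (auto simp: CUp_def)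
  moreover have "{\<sigma>} \<subseteq> fextreme_points {\<sigma>}" by (auto simp: fextreme_points_def)
  moreover have "\<forall>i\<in>I. \<bar>\<sigma> i - \<sigma> i\<bar> < e" using e by simp
  ultimately show ?case using singleton by (intro exI[of _ "{\<sigma>}"]) blast
next
  case (insert \<nu>0 S)
  then obtain G E where G: "G \<in> CUp" and E: "finite E" "E \<subseteq> fextreme_points G"
    and SE: "\<forall>\<sigma>\<in>S. \<exists>\<tau>\<in>E. \<forall>i\<in>I. \<bar>\<sigma> i - \<tau> i\<bar> < e"
    and GF: "\<forall>\<tau>\<in>G. \<exists>\<sigma>\<in>F. \<forall>i\<in>I. \<bar>\<sigma> i - \<tau> i\<bar> < e"
    and ker: "\<forall>y. (\<forall>\<tau>\<in>E. \<tau> y = 0) \<longrightarrow> (\<forall>\<tau>\<in>G. \<tau> y = 0)"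
    by auto
  have \<nu>0: "\<nu>0 \<in> F" "\<nu>0 \<in> Pdual" using insert.prems CUpD(4)[OF F] by auto
  have "E \<subseteq> G" using E(2) by (auto simp: fextreme_points_def)
  then have lin: "linear f" if "f \<in> insert \<nu>0 E" for f
    using that CUp_linear[OF G] Pdual_linear[OF \<nu>0(2)] by blast
  \<comment> \<open>Including \<open>\<nu>0\<close> makes the value of the perturbed vertex at
    \<open>y\<close> come from the added functional \<open>\<tau>\<close> alone, so its sign is
    known.\<close>
  obtain z where z: "z \<noteq> 0" "\<And>f. f \<in> insert \<nu>0 E \<Longrightarrow> f z = 0"
    using common_kernel_nonzero[of "insert \<nu>0 E"] E(1) lin by blast
  obtain \<tau> where \<tau>: "\<tau> \<in> Pdual" "\<tau> z \<noteq> 0" using Pdual_separates[OF z(1)] by blast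
  define y where "y = sgn (\<tau> z) *\<^sub>R z"
  have \<tau>y: "\<tau> y > 0" using \<tau> by (simp add: y_def linear_scale[OF Pdual_linear] sgn_if)
  have y: "f y = 0" if "f \<in> insert \<nu>0 E" for f
    using z(2)[OF that] linear_scale[OF lin[OF that]] by (simp add: y_def)
  define m where "m = 1 + (\<Sum>i\<in>I. \<bar>\<tau> i\<bar>)"
  have m: "m > 0" "\<And>i. i \<in> I \<Longrightarrow> \<bar>\<tau> i\<bar> < m"
  proof -
    have "(\<Sum>i\<in>I. \<bar>\<tau> i\<bar>) \<ge> 0" by (rule sum_nonneg) simp
    then show "m > 0" unfolding m_def by linarith
    fix i assume "i \<in> I"
    then have "\<bar>\<tau> i\<bar> \<le> (\<Sum>i\<in>I. \<bar>\<tau> i\<bar>)" by (rule member_le_sum[where f = "\<lambda>i. \<bar>\<tau> i\<bar>"]) (simp_all add: I)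
    then show "\<bar>\<tau> i\<bar> < m" by (simp add: m_def)
  qed
  define d where "d = e / m"
  have d: "d > 0" "d * m = e" using e m by (auto simp: d_def)
  define \<nu> where "\<nu> = (\<lambda>x. 1 * \<nu>0 x + d * \<tau> x)"
  have \<nu>: "\<nu> \<in> Pdual" unfolding \<nu>_def using \<nu>0 \<tau> d by (intro Pdual_convex) auto
  have \<nu>y: "\<nu> y > 0" using y[of \<nu>0] \<tau>y d by (simp add: \<nu>_def)
  have near: "\<bar>\<nu>0 i - \<nu> i\<bar> < e" if "i \<in> I" for i
  proof -
    have "\<bar>\<nu>0 i - \<nu> i\<bar> = d * \<bar>\<tau> i\<bar>" using d(1) by (simp add: \<nu>_def abs_mult)
    also have "\<dots> < d * m" using m(2)[OF that] d(1) by simp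
    finally show ?thesis using d(2) by simp
  qed
  have Gy: "g y = 0" if "g \<in> G" for g using ker y that by blast
  let ?G = "cone_over \<nu> G"
  have "?G \<in> CUp" by (rule cone_over_CUp[OF G \<nu>])
  moreover have "finite (insert \<nu> E)" using E(1) by simp
  moreover have "insert \<nu> E \<subseteq> fextreme_points ?G"
  proof -
    have "insert \<nu> (fextreme_points G) \<subseteq> fextreme_points ?G"
      using Gy \<nu>y by (intro cone_over_extreme[where y = y] CUpD(1)[OF G])
    then show ?thesis using E(2) by blast
  qed
  moreover have "\<forall>\<sigma>\<in>insert \<nu>0 S. \<exists>\<tau>\<in>insert \<nu> E. \<forall>i\<in>I. \<bar>\<sigma> i - \<tau> i\<bar> < e"
    using SE near by blast
  moreover have "\<forall>\<rho>\<in>?G. \<exists>\<sigma>\<in>F. \<forall>i\<in>I. \<bar>\<sigma> i - \<rho> i\<bar> < e"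
  proof
    fix \<rho> assume "\<rho> \<in> cone_over \<nu> G"
    obtain t g where t: "0 \<le> t" "t \<le> 1" "g \<in> G" "\<rho> = (\<lambda>x. (1 - t) * g x + t * \<nu> x)"
      using \<open>\<rho> \<in> cone_over \<nu> G\<close> by (rule cone_overE)
    obtain \<sigma> where \<sigma>: "\<sigma> \<in> F" "\<forall>i\<in>I. \<bar>\<sigma> i - g i\<bar> < e" using GF t(3) by blast
    \<comment> \<open>The partner in \<open>F\<close> uses the same parameter with the unperturbed
      vertex \<open>\<nu>0\<close> and the partner of \<open>g\<close>; both errors are below
      \<open>e\<close>, hence so is their convex combination.\<close>
    have "(\<lambda>x. t * \<nu>0 x + (1 - t) * \<sigma> x) \<in> F"
      using CUpD(2)[OF F] \<sigma>(1) \<nu>0(1) t(1,2) unfolding fconvex_def by blast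
    moreover have "\<bar>(t * \<nu>0 i + (1 - t) * \<sigma> i) - \<rho> i\<bar> < e" if "i \<in> I" for i
    proof -
      have 1: "\<bar>\<sigma> i - g i\<bar> < e" "\<bar>\<nu>0 i - \<nu> i\<bar> < e" using \<sigma>(2) near[OF that] that by blast+
      have "(t * \<nu>0 i + (1 - t) * \<sigma> i) - \<rho> i = t * (\<nu>0 i - \<nu> i) + (1 - t) * (\<sigma> i - g i)"
        by (simp add: t(4) algebra_simps)
      also have "\<bar>\<dots>\<bar> \<le> t * \<bar>\<nu>0 i - \<nu> i\<bar> + (1 - t) * \<bar>\<sigma> i - g i\<bar>"
        by (rule order_trans[OF abs_triangle_ineq]) (simp add: abs_mult t(1,2))
      also have "\<dots> < e"
        by (rule convex_bound_lt[OF 1(2,1)]) (simp_all add: t(1,2))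
      finally show ?thesis .
    qed
    ultimately show "\<exists>\<sigma>\<in>F. \<forall>i\<in>I. \<bar>\<sigma> i - \<rho> i\<bar> < e" by (intro bexI[of _ "\<lambda>x. t * \<nu>0 x + (1 - t) * \<sigma> x"] ballI)
  qed
  moreover have "\<forall>x. (\<forall>\<tau>\<in>insert \<nu> E. \<tau> x = 0) \<longrightarrow> (\<forall>\<tau>\<in>?G. \<tau> x = 0)"
  proof (intro allI impI ballI)
    fix x \<rho> assume van: "\<forall>\<tau>\<in>insert \<nu> E. \<tau> x = 0" and \<rho>: "\<rho> \<in> ?G"
    obtain t g where t: "g \<in> G" "\<rho> = (\<lambda>x. (1 - t) * g x + t * \<nu> x)"
      using \<rho> by (rule cone_overE)
    have "g x = 0" using ker van t(1) by blast
    then show "\<rho> x = 0" using van t(2) by simp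
  qed
  ultimately show ?case by (intro exI[of _ ?G] exI[of _ "insert \<nu> E"] conjI)
qed

lemma dense_almost_extremal: "CUp_top closure_of almost_extremal k = topspace CUp_top"
proof (rule subset_antisym[OF closure_of_subset_topspace], rule subsetI)
  fix F assume "F \<in> topspace CUp_top"
  then have F: "F \<in> CUp" by (simp add: topspace_CUp_top)
  show "F \<in> CUp_top closure_of almost_extremal k"
    unfolding in_closure_of
  proof (intro conjI allI impI)
    show "F \<in> topspace CUp_top" by fact
    fix T assume "F \<in> T \<and> openin CUp_top T"
    then obtain J d where J: "finite J" "d > 0"
      "\<And>G. G \<in> CUp \<Longrightarrow> \<forall>x\<in>J. \<bar>supp G x - supp F x\<bar> < d \<Longrightarrow> G \<in> T"
      unfolding openin_CUp_top_iff by blast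
    define I where "I = J \<union> a ` {..k}"
    have I: "finite I" "J \<subseteq> I" "\<And>i. i \<le> k \<Longrightarrow> a i \<in> I" using J(1) by (auto simp: I_def)
    define r where "r = 1 / (2 * real (Suc k))"
    \<comment> \<open>Passing from \<open>F\<close> through \<open>S\<close> to the vertices costs
      2e, which must stay below \<open>d\<close>. Starting from a point of \<open>G\<close> costs
      one more \<open>e\<close>, and 3e must fit into the half scale \<open>r\<close>.\<close>
    define e where "e = min (d / 3) (r / 3)"
    have r: "r > 0" by (simp add: r_def)
    have e: "e > 0" "2 * e < d" "3 * e \<le> r" using J(2) r by (auto simp: e_def)
    have "\<exists>\<tau>\<in>F. \<forall>i\<in>I. \<bar>\<sigma> i - \<tau> i\<bar> < e" if "\<sigma> \<in> F" for \<sigma> using that e(1) by (intro bexI[of _ \<sigma>]) auto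
    then obtain S where S: "finite S" "S \<subseteq> F" "\<And>\<sigma>. \<sigma> \<in> F \<Longrightarrow> \<exists>\<tau>\<in>S. \<forall>i\<in>I. \<bar>\<sigma> i - \<tau> i\<bar> < e"
      using finite_net[OF CUpD(6)[OF F] I(1) e(1), of F] by blast
    have "S \<noteq> {}" using S(3) CUpD(1)[OF F] by blast
    then obtain G E where G: "G \<in> CUp" and E: "finite E" "E \<subseteq> fextreme_points G"
      and SE: "\<forall>\<sigma>\<in>S. \<exists>\<tau>\<in>E. \<forall>i\<in>I. \<bar>\<sigma> i - \<tau> i\<bar> < e"
      and GF: "\<forall>\<tau>\<in>G. \<exists>\<sigma>\<in>F. \<forall>i\<in>I. \<bar>\<sigma> i - \<tau> i\<bar> < e"
      using simplex_approximation[OF F I(1) e(1) S(1) _ S(2)] by blast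
    have EG: "E \<subseteq> G" using E(2) by (auto simp: fextreme_points_def)
    have FE: "\<exists>\<tau>\<in>E. \<forall>i\<in>I. \<bar>\<sigma> i - \<tau> i\<bar> < 2 * e" if \<sigma>: "\<sigma> \<in> F" for \<sigma>
    proof -
      obtain \<rho> where \<rho>: "\<rho> \<in> S" "\<forall>i\<in>I. \<bar>\<sigma> i - \<rho> i\<bar> < e" using S(3)[OF \<sigma>] by blast
      obtain \<tau> where \<tau>: "\<tau> \<in> E" "\<forall>i\<in>I. \<bar>\<rho> i - \<tau> i\<bar> < e" using SE \<rho>(1) by blast
      have "\<bar>\<sigma> i - \<tau> i\<bar> < 2 * e" if "i \<in> I" for i
      proof -
        have "\<bar>\<sigma> i - \<rho> i\<bar> < e" "\<bar>\<rho> i - \<tau> i\<bar> < e" using \<rho>(2) \<tau>(2) that by auto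
        then show ?thesis by linarith
      qed
      then show ?thesis using \<tau>(1) by blast
    qed
    have "hclose I (2 * e) F G"
      unfolding hclose_def
    proof (intro conjI ballI)
      fix \<sigma> assume "\<sigma> \<in> F"
      then show "\<exists>\<tau>\<in>G. \<forall>i\<in>I. \<bar>\<sigma> i - \<tau> i\<bar> < 2 * e" using FE EG by blast
    next
      fix \<tau> assume "\<tau> \<in> G"
      then obtain \<sigma> where \<sigma>: "\<sigma> \<in> F" "\<forall>i\<in>I. \<bar>\<sigma> i - \<tau> i\<bar> < e" using GF by blast
      then have "\<forall>i\<in>I. \<bar>\<sigma> i - \<tau> i\<bar> < 2 * e" using e(1) by force
      then show "\<exists>\<sigma>\<in>F. \<forall>i\<in>I. \<bar>\<sigma> i - \<tau> i\<bar> < 2 * e" using \<sigma>(1) by blast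
    qed
    then have "\<bar>supp G x - supp F x\<bar> < d" if "x \<in> J" for x
      using hclose_imp_supp_close[OF F G, of I "2 * e" x] that I(2) e(2) by force
    then have "G \<in> T" using J(3)[OF G] by blast
    moreover have "G \<in> almost_extremal k"
    proof (rule almost_extremal_I[OF G E])
      fix \<sigma> assume "\<sigma> \<in> G"
      then obtain \<rho> where \<rho>: "\<rho> \<in> F" "\<forall>i\<in>I. \<bar>\<rho> i - \<sigma> i\<bar> < e" using GF by blast
      obtain \<tau> where \<tau>: "\<tau> \<in> E" "\<forall>i\<in>I. \<bar>\<rho> i - \<tau> i\<bar> < 2 * e" using FE[OF \<rho>(1)] by blast
      have "\<bar>\<sigma> (a i) - \<tau> (a i)\<bar> < 1 / (2 * real (Suc k))" if "i \<le> k" for i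
      proof -
        have "\<bar>\<rho> (a i) - \<sigma> (a i)\<bar> < e" "\<bar>\<rho> (a i) - \<tau> (a i)\<bar> < 2 * e"
          using \<rho>(2) \<tau>(2) I(3)[OF that] by auto
        then show ?thesis using e(3) unfolding r_def by linarith
      qed
      then show "\<exists>\<tau>\<in>E. \<forall>i\<le>k. \<bar>\<sigma> (a i) - \<tau> (a i)\<bar> < 1 / (2 * real (Suc k))" using \<tau>(1) by blast
    qed
    ultimately show "\<exists>G. G \<in> almost_extremal k \<and> G \<in> T" by blast
  qed
qed

theorem Dp_dense: "CUp_top closure_of Dp = CUp"
proof -
  have "CUp_top closure_of \<Inter>(range almost_extremal) = topspace CUp_top"
    using locally_compact_regular_CUp_top openin_almost_extremal dense_almost_extremal by (intro Baire_category) auto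
  then show ?thesis by (simp add: Dp_eq topspace_CUp_top)
qed

theorem Dp_gdelta: "gdelta_in CUp_top Dp"
  unfolding Dp_eq using openin_almost_extremal by (intro gdelta_in_Inter open_imp_gdelta_in) (auto intro: open_imp_gdelta_in)

end

section \<open>From ordered vector topologies to order units\<close>

text \<open>Gaussian elimination on the number of equations: if some \<open>M s0 b\<close> is
  nonzero, it serves as pivot for \<open>b\<close>.\<close>

lemma underdetermined_system:
  fixes M :: "'s \<Rightarrow> 'b \<Rightarrow> real"
  assumes "finite B"
  shows "finite S \<Longrightarrow> card B < card S \<Longrightarrow> \<exists>c. (\<exists>s\<in>S. c s \<noteq> 0) \<and> (\<forall>b\<in>B. (\<Sum>s\<in>S. c s * M s b) = 0)"
  using assms
proof (induction B arbitrary: S M rule: finite_induct)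
  case empty
  then have "S \<noteq> {}" by auto
  then show ?case by (intro exI[of _ "\<lambda>_. 1"]) auto
next
  case (insert b B)
  show ?case
  proof (cases "\<forall>s\<in>S. M s b = 0")
    case True
    have "card B < card S" using insert by simp
    then obtain c where "\<exists>s\<in>S. c s \<noteq> 0" "\<forall>b\<in>B. (\<Sum>s\<in>S. c s * M s b) = 0"
      using insert.IH[of S M] insert.prems(1) by blast
    then show ?thesis using True by (intro exI[of _ c]) auto
  next
    case False
    then obtain s0 where s0: "s0 \<in> S" "M s0 b \<noteq> 0" by blast
    let ?S = "S - {s0}"
    \<comment> \<open>Subtracting multiples of row \<open>s0\<close> clears column \<open>b\<close>;
      the coefficient of \<open>s0\<close> in \<open>c'\<close> undoes the subtraction.\<close>
    define M' where "M' = (\<lambda>s b'. M s b' - M s b / M s0 b * M s0 b')"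
    have "card B < card ?S" using insert s0(1) by simp
    then obtain c where c: "\<exists>s\<in>?S. c s \<noteq> 0" "\<forall>b'\<in>B. (\<Sum>s\<in>?S. c s * M' s b') = 0"
      using insert.IH[of ?S M'] insert.prems(1) by blast
    define c' where "c' = c(s0 := - (\<Sum>s\<in>?S. c s * (M s b / M s0 b)))"
    have sum: "(\<Sum>s\<in>S. c' s * M s b') = (\<Sum>s\<in>?S. c s * M' s b')" for b'
    proof -
      have "(\<Sum>s\<in>S. c' s * M s b') = c' s0 * M s0 b' + (\<Sum>s\<in>?S. c' s * M s b')"
        using insert.prems(1) s0(1) by (rule sum.remove)
      also have "(\<Sum>s\<in>?S. c' s * M s b') = (\<Sum>s\<in>?S. c s * M s b')"
        by (intro sum.cong) (auto simp: c'_def)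
      also have "c' s0 * M s0 b' = (\<Sum>s\<in>?S. - (c s * (M s b / M s0 b) * M s0 b'))"
        by (simp add: c'_def sum_distrib_right sum_negf)
      also have "\<dots> + (\<Sum>s\<in>?S. c s * M s b') = (\<Sum>s\<in>?S. c s * M' s b')"
        unfolding sum.distrib[symmetric] by (intro sum.cong) (auto simp: M'_def right_diff_distrib)
      finally show ?thesis .
    qed
    have "(\<Sum>s\<in>?S. c s * M' s b) = 0" using s0(2) by (simp add: M'_def)
    then have "\<forall>b'\<in>insert b B. (\<Sum>s\<in>S. c' s * M s b') = 0" using c(2) by (simp add: sum)
    moreover have "\<exists>s\<in>S. c' s \<noteq> 0" using c(1) by (auto simp: c'_def)
    ultimately show ?thesis by blast
  qed
qed

text \<open>More functionals than spanning vectors admit a nontrivial combination that vanishes on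
  \<open>B\<close>, hence everywhere, against independence.\<close>

lemma infinite_dual_imp_infinite_dimensional:
  fixes S :: "('a::real_vector \<Rightarrow> real) set"
  assumes S: "infinite S" "fun_lin_indep S" "\<And>\<sigma>. \<sigma> \<in> S \<Longrightarrow> linear \<sigma>" and B: "finite B"
  shows "span B \<noteq> (UNIV :: 'a set)"
proof
  assume span: "span B = (UNIV :: 'a set)"
  obtain S' where S': "finite S'" "card S' = Suc (card B)" "S' \<subseteq> S"
    using infinite_arbitrarily_large[OF S(1)] by blast
  obtain c where c: "\<exists>\<sigma>\<in>S'. c \<sigma> \<noteq> 0" "\<forall>b\<in>B. (\<Sum>\<sigma>\<in>S'. c \<sigma> * \<sigma> b) = 0"
    using underdetermined_system[OF B S'(1), of "\<lambda>\<sigma>. \<sigma>"] S'(2) by auto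
  have lin: "linear \<sigma>" if "\<sigma> \<in> S'" for \<sigma> using S(3) S'(3) that by blast
  let ?f = "\<lambda>x. \<Sum>\<sigma>\<in>S'. c \<sigma> * \<sigma> x"
  have "?f x = 0" for x
  proof -
    have "linear ?f"
      by (intro linearI)
        (simp_all add: lin linear_add linear_scale sum.distrib[symmetric] sum_distrib_left algebra_simps)
    moreover have "x \<in> span B" using span by simp
    ultimately show ?thesis using linear_eq_0_on_span[of ?f B x] c(2) by blast
  qed
  then have "\<forall>\<sigma>\<in>S'. c \<sigma> = 0" using S(2) S'(1,3) unfolding fun_lin_indep_def by blast
  then show False using c(1) by blast
qed

section \<open>Affine maps and absorption in the vector topology\<close>

lemma lc_tvs_continuous_affine:
  assumes T: "lc_tvs T"
  shows "continuous_map T T (\<lambda>z. c *\<^sub>R z + w)" and "continuous_map euclideanreal T (\<lambda>s. s *\<^sub>R x)"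
proof -
  have top: "topspace T = UNIV"
    and add: "continuous_map (prod_topology T T) T (\<lambda>(x, y). x + y)"
    and scale: "continuous_map (prod_topology euclideanreal T) T (\<lambda>(c, x). c *\<^sub>R x)"
    using T by (auto simp: lc_tvs_def)
  have "continuous_map T (prod_topology euclideanreal T) (\<lambda>z. (c, z))"
    by (intro continuous_map_pairedI) (auto simp: continuous_map_id[unfolded id_def])
  from continuous_map_compose[OF this scale] have 1: "continuous_map T T (\<lambda>z. c *\<^sub>R z)"
    by (simp add: o_def)
  have "continuous_map T (prod_topology T T) (\<lambda>z. (c *\<^sub>R z, w))"
    by (intro continuous_map_pairedI 1) (auto simp: top)
  from continuous_map_compose[OF this add] show "continuous_map T T (\<lambda>z. c *\<^sub>R z + w)"
    by (simp add: o_def)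
  have "continuous_map euclideanreal (prod_topology euclideanreal T) (\<lambda>s. (s, x))"
    by (intro continuous_map_pairedI) (auto simp: top continuous_map_id[unfolded id_def])
  from continuous_map_compose[OF this scale] show "continuous_map euclideanreal T (\<lambda>s. s *\<^sub>R x)"
    by (simp add: o_def)
qed

lemma lc_tvs_absorbing:
  assumes T: "lc_tvs T" and U: "openin T U" "0 \<in> U"
  shows "\<exists>t>0. t *\<^sub>R x \<in> U"
proof -
  have "openin euclideanreal {s \<in> topspace euclideanreal. s *\<^sub>R x \<in> U}"
    using lc_tvs_continuous_affine(2)[OF T] U(1) by (rule openin_continuous_map_preimage)
  then have "open {s. s *\<^sub>R x \<in> U}" by simp
  moreover have "0 \<in> {s. s *\<^sub>R x \<in> U}" using U(2) by simp
  ultimately obtain e where "e > 0" "ball 0 e \<subseteq> {s. s *\<^sub>R x \<in> U}" unfolding open_contains_ball by blast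
  moreover have "e / 2 \<in> ball 0 e" using \<open>e > 0\<close> by simp
  ultimately have "e / 2 > 0" "e / 2 \<in> {s. s *\<^sub>R x \<in> U}" by (simp, blast)
  then show ?thesis by blast
qed

theorem theorem4p16:
  fixes T :: "'a::real_vector topology" and P :: "'a set"
  assumes "lc_tvs T"
    and "separable_space T"
    and "completely_metrizable_space T"
    and "cvx_cone P"
    and "\<forall>U. zero_nbhd T U \<longrightarrow> (\<exists>A1 A2 U'. zero_nbhd T U'
            \<and> U' \<subseteq> order_interval P A1 A2 \<and> order_interval P A1 A2 \<subseteq> U)"
    and "\<exists>U. zero_nbhd T U \<and> infinite_dim_cond T U"
  shows "(subtopology wstar_hausdorff (CU_plus T P)) closure_of (D_plus T P) = CU_plus T P
       \<and> gdelta_in (subtopology wstar_hausdorff (CU_plus T P)) (D_plus T P)"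
proof -
  note T = assms(1)
  have top: "topspace T = UNIV" using T by (simp add: lc_tvs_def)
  have add: "x + y \<in> P" if "x \<in> P" "y \<in> P" for x y using assms(4) that by (auto simp: cvx_cone_def)
  have scale: "c *\<^sub>R x \<in> P" if "c > 0" "x \<in> P" for c x using assms(4) that by (auto simp: cvx_cone_def)
  have intervals: "\<exists>A1 A2 V. openin T V \<and> 0 \<in> V \<and> (\<forall>x\<in>V. x - A1 \<in> P \<and> A2 - x \<in> P)
      \<and> (\<forall>x. x - A1 \<in> P \<and> A2 - x \<in> P \<longrightarrow> x \<in> U)" if U: "openin T U" "0 \<in> U" for U
  proof -
    have "zero_nbhd T U" using U unfolding zero_nbhd_def by blast
    then obtain A1 A2 U' where *: "zero_nbhd T U'" "U' \<subseteq> order_interval P A1 A2" "order_interval P A1 A2 \<subseteq> U"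
      using assms(5) by blast
    from *(1) obtain V where "openin T V" "0 \<in> V" "V \<subseteq> U'" unfolding zero_nbhd_def by blast
    with *(2,3) show ?thesis
      unfolding order_interval_def cone_le_def by (intro exI[of _ A1] exI[of _ A2] exI[of _ V]) auto
  qed
  have UNIV: "openin T UNIV" using openin_topspace[of T] by (simp add: top)
  \<comment> \<open>Any interval around a 0-neighborhood provides an order unit, so the hypothesis
    is applied to the whole space.\<close>
  then obtain u V0 where V0: "openin T V0" "0 \<in> V0" "\<And>x. x \<in> V0 \<Longrightarrow> u - x \<in> P"
    using intervals[of UNIV] by blast
  define V where "V = V0 \<inter> {x \<in> topspace T. (- 1) *\<^sub>R x + 0 \<in> V0}"
  have V: "openin T V" "0 \<in> V" "\<And>x. x \<in> V \<Longrightarrow> u - x \<in> P \<and> u + x \<in> P"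
  proof -
    show "openin T V" unfolding V_def
      by (intro openin_Int V0 openin_continuous_map_preimage[OF lc_tvs_continuous_affine(1)[OF T]])
    show "0 \<in> V" using V0(2) by (simp add: V_def top)
    fix x assume "x \<in> V"
    then show "u - x \<in> P \<and> u + x \<in> P" using V0(3)[of x] V0(3)[of "- x"] by (simp add: V_def)
  qed
  \<comment> \<open>For t > 0 this is \<open>x\<close> plus \<open>t\<close> times \<open>V\<close>,
    written as a preimage so that it is open by continuity of an affine map.\<close>
  define W where "W x t = {z. (1 / t) *\<^sub>R z + (- (1 / t)) *\<^sub>R x \<in> V}" for x and t :: real
  have W: "openin T (W x t)" "x \<in> W x t" for x t
  proof -
    have "openin T {z \<in> topspace T. (1 / t) *\<^sub>R z + (- (1 / t)) *\<^sub>R x \<in> V}"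
      using lc_tvs_continuous_affine(1)[OF T] V(1) by (rule openin_continuous_map_preimage)
    then show "openin T (W x t)" by (simp add: W_def top)
    show "x \<in> W x t" using V(2) by (simp add: W_def)
  qed
  have Wbound: "t *\<^sub>R u - (z - x) \<in> P \<and> t *\<^sub>R u + (z - x) \<in> P" if "t > 0" "z \<in> W x t" for x z t
  proof -
    let ?v = "(1 / t) *\<^sub>R z + (- (1 / t)) *\<^sub>R x"
    have "u - ?v \<in> P \<and> u + ?v \<in> P" using V(3) that(2) by (simp add: W_def)
    then have "t *\<^sub>R (u - ?v) \<in> P" "t *\<^sub>R (u + ?v) \<in> P" using scale[OF that(1)] by auto
    moreover have "t *\<^sub>R ?v = z - x" using that(1) by (simp add: algebra_simps)
    ultimately show ?thesis unfolding scaleR_diff_right scaleR_add_right by simp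
  qed
  have Haus: "Hausdorff_space T"
    using assms(3) by (intro metrizable_imp_Hausdorff_space completely_metrizable_imp_metrizable_space)
  obtain D where D: "countable D" "T closure_of D = topspace T"
    using assms(2) unfolding separable_space_def by blast
  define a where "a = from_nat_into D"
  have dense: "\<exists>n. a n \<in> W x t" for x t
  proof -
    have "x \<in> T closure_of D" using D(2) top by simp
    then obtain y where y: "y \<in> D" "y \<in> W x t" using W[of x t] unfolding in_closure_of by blast
    obtain n where "a n = y" unfolding a_def using from_nat_into_surj[OF D(1) y(1)] by blast
    then show ?thesis using y(2) by blast
  qed
  interpret order_unit_space P u a
  proof
    show "cvx_cone P" by (rule assms(4))
    show "u \<in> P" using V(2,3) by fastforce
  next
    fix x
    obtain t where t: "t > 0" "t *\<^sub>R x \<in> V" using lc_tvs_absorbing[OF T V(1,2)] by blast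
    then have "(1 / t) *\<^sub>R (u - t *\<^sub>R x) \<in> P" using V(3) by (intro scale) auto
    then show "\<exists>t>0. t *\<^sub>R u - x \<in> P" using t(1) by (intro exI[of _ "1 / t"]) (simp add: algebra_simps)
  next
    fix y assume y: "\<And>t. t > 0 \<Longrightarrow> t *\<^sub>R u - y \<in> P \<and> t *\<^sub>R u + y \<in> P"
    show "y = 0"
    proof (rule ccontr)
      assume "y \<noteq> 0"
      then obtain U where U: "openin T U" "0 \<in> U" "y \<notin> U"
        using Haus top unfolding Hausdorff_space_def disjnt_def by (metis UNIV_I disjoint_iff)
      obtain A1 A2 U' where U': "openin T U'" "0 \<in> U'" "\<forall>x\<in>U'. x - A1 \<in> P \<and> A2 - x \<in> P"
        "\<forall>x. x - A1 \<in> P \<and> A2 - x \<in> P \<longrightarrow> x \<in> U"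
        using intervals[OF U(1,2)] by blast
      \<comment> \<open>Small multiples of \<open>u\<close> and \<open>- u\<close> lie in the
        interval. Since \<open>y\<close> is below \<open>s *\<^sub>R u\<close> and above
        \<open>- t *\<^sub>R u\<close>, it lies in the interval too, hence in
        \<open>U\<close>.\<close>
      obtain s where s: "s > 0" "s *\<^sub>R u \<in> U'" using lc_tvs_absorbing[OF T U'(1,2)] by blast
      obtain t where t: "t > 0" "t *\<^sub>R (- u) \<in> U'" using lc_tvs_absorbing[OF T U'(1,2)] by blast
      have *: "A2 - s *\<^sub>R u \<in> P" "t *\<^sub>R (- u) - A1 \<in> P" using U'(3) s(2) t(2) by auto
      have "(A2 - s *\<^sub>R u) + (s *\<^sub>R u - y) \<in> P" using *(1) conjunct1[OF y[OF s(1)]] by (rule add)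
      moreover have "(t *\<^sub>R u + y) + (t *\<^sub>R (- u) - A1) \<in> P" using conjunct2[OF y[OF t(1)]] *(2) by (rule add)
      ultimately have "y \<in> U" using U'(4) by simp
      then show False using U(3) by simp
    qed
  next
    fix x and e :: real assume e: "e > 0"
    obtain n where "a n \<in> W x e" using dense by blast
    from Wbound[OF e this] show "\<exists>n. e *\<^sub>R u - (x - a n) \<in> P \<and> e *\<^sub>R u + (x - a n) \<in> P"
      by (intro exI[of _ n]) (simp add: algebra_simps)
  next
    fix B :: "'a set" assume B: "finite B"
    obtain S where S: "S \<subseteq> tdual T" "infinite S" "fun_lin_indep S"
      using assms(6) unfolding infinite_dim_cond_def by (elim exE conjE)
    have "linear \<sigma>" if "\<sigma> \<in> S" for \<sigma> using that S(1) unfolding tdual_def by blast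
    then show "span B \<noteq> UNIV" by (rule infinite_dual_imp_infinite_dimensional[OF S(2,3) _ B])
  qed
  have Pdual_cont: "continuous_map T euclideanreal \<sigma>" if \<sigma>: "\<sigma> \<in> Pdual" for \<sigma>
    unfolding continuous_map_def
  proof (intro conjI allI impI)
    fix O' assume "openin euclideanreal O'"
    then have O': "open O'" by simp
    show "openin T {x \<in> topspace T. \<sigma> x \<in> O'}"
    proof (subst openin_subopen, intro ballI)
      fix x assume "x \<in> {x \<in> topspace T. \<sigma> x \<in> O'}"
      then obtain e where e: "e > 0" "\<And>r. \<bar>r - \<sigma> x\<bar> < e \<Longrightarrow> r \<in> O'"
        using O' unfolding open_dist dist_real_def by blast
      \<comment> \<open>The summand 1 keeps the denominator positive and makes
        \<open>t * \<sigma> u\<close> strictly smaller than \<open>e\<close>.\<close>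
      define t where "t = e / (\<sigma> u + 1)"
      have su: "\<sigma> u \<ge> 0" using Pdual_nonneg[OF \<sigma> unit] .
      have t: "t > 0" "t * \<sigma> u < e" using su e(1) by (auto simp: t_def field_simps)
      have "\<sigma> z \<in> O'" if "z \<in> W x t" for z
        using Pdual_diff_bound[OF \<sigma> t(1), of z x] Wbound[OF t(1) that] t(2) by (intro e(2)) auto
      then show "\<exists>N. openin T N \<and> x \<in> N \<and> N \<subseteq> {x \<in> topspace T. \<sigma> x \<in> O'}"
        using W[of x t] top by (intro exI[of _ "W x t"]) auto
    qed
  qed auto
  have Pdual_eq: "dual_cone T P = Pdual"
    using Pdual_cont by (auto simp: dual_cone_def tdual_def Pdual_def)
  have Pdual_tdual: "Pdual \<subseteq> tdual T" using Pdual_eq by (auto simp: dual_cone_def)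
  have wstar: "wstar T = top_of_set (tdual T)"
    unfolding wstar_def euclidean_product_topology ..
  have CU: "CU_plus T P = CUp"
  proof (intro equalityI subsetI)
    fix F assume "F \<in> CU_plus T P"
    then obtain U where U: "zero_nbhd T U" "F \<noteq> {}" "fconvex F" "closedin (wstar T) F" "F \<subseteq> polar T U" "F \<subseteq> Pdual"
      unfolding CU_plus_def CU_U_def Pdual_eq by blast
    \<comment> \<open>The dual is in general not closed in the product, so \<open>F\<close> is only
      relatively closed. It becomes closed because it lies in \<open>Pdual\<close>, which
      is.\<close>
    obtain C where "closed C" "F = tdual T \<inter> C"
      using U(4) unfolding wstar closedin_closed by blast
    then have "F = C \<inter> Pdual" "closed C" using U(6) Pdual_tdual by auto
    then have "closed F" using closed_Pdual by auto
    moreover have "\<exists>c. \<forall>\<sigma>\<in>F. \<sigma> u \<le> c"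
    proof -
      obtain N where "openin T N" "0 \<in> N" "N \<subseteq> U" using U(1) unfolding zero_nbhd_def by blast
      \<comment> \<open>A 0-neighborhood contains some positive multiple of \<open>u\<close>, so
        membership in its polar bounds the values at \<open>u\<close>.\<close>
      then obtain t where t: "t > 0" "t *\<^sub>R u \<in> U" using lc_tvs_absorbing[OF T, of N u] by blast
      have "\<sigma> u \<le> 1 / t" if "\<sigma> \<in> F" for \<sigma>
      proof -
        have "\<bar>\<sigma> (t *\<^sub>R u)\<bar> \<le> 1" using that U(5) t(2) by (auto simp: polar_def)
        moreover have "linear \<sigma>" using that U(6) Pdual_linear by blast
        ultimately have "t * \<sigma> u \<le> 1" by (simp add: linear_scale)
        then show ?thesis using t(1) by (simp add: field_simps)
      qed
      then show ?thesis by blast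
    qed
    ultimately show "F \<in> CUp" unfolding CUp_def using U by blast
  next
    fix F assume F: "F \<in> CUp"
    obtain c where c: "\<And>\<sigma>. \<sigma> \<in> F \<Longrightarrow> \<sigma> u \<le> c" using CUpD(5)[OF F] by blast
    \<comment> \<open>Conversely, a bound \<open>c\<close> at \<open>u\<close> puts \<open>F\<close>
      into the polar of \<open>W 0 t\<close> as soon as \<open>t * c\<close> is at most 1.\<close>
    define t where "t = 1 / (\<bar>c\<bar> + 1)"
    have t: "t > 0" by (simp add: t_def)
    have tc: "t * c \<le> 1" by (simp add: t_def field_simps)
    have "zero_nbhd T (W 0 t)" unfolding zero_nbhd_def using W[of 0 t] by blast
    moreover have "F \<subseteq> polar T (W 0 t)"
    proof
      fix \<sigma> assume \<sigma>: "\<sigma> \<in> F"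
      then have P: "\<sigma> \<in> Pdual" using CUpD(4)[OF F] by blast
      have "\<bar>\<sigma> z\<bar> \<le> 1" if "z \<in> W 0 t" for z
      proof -
        have "\<bar>\<sigma> z - \<sigma> 0\<bar> \<le> t * \<sigma> u"
          using Pdual_diff_bound[OF P t, of z 0] Wbound[OF t that] by simp
        also have "\<dots> \<le> t * c" using c[OF \<sigma>] t by simp
        finally show ?thesis using tc linear_0[OF Pdual_linear[OF P]] by simp
      qed
      then show "\<sigma> \<in> polar T (W 0 t)" using P Pdual_tdual by (auto simp: polar_def)
    qed
    moreover have "closedin (wstar T) F"
      unfolding wstar using CUpD(3,4)[OF F] Pdual_tdual by (intro closed_subset) auto
    ultimately show "F \<in> CU_plus T P"
      unfolding CU_plus_def CU_U_def Pdual_eq using CUpD(1,2,4)[OF F] by blast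
  qed
  have "D_plus T P = Dp"
  proof -
    have cl: "wstar T closure_of fextreme_points F = closure (fextreme_points F)" if F: "F \<in> CUp" for F
    proof -
      have sub: "fextreme_points F \<subseteq> F" by (auto simp: fextreme_points_def)
      then have "fextreme_points F \<subseteq> tdual T" using CUpD(4)[OF F] Pdual_tdual by blast
      then have 1: "tdual T \<inter> fextreme_points F = fextreme_points F" by blast
      have "closure (fextreme_points F) \<subseteq> F" using sub CUpD(3)[OF F] by (rule closure_minimal)
      then have "closure (fextreme_points F) \<subseteq> tdual T" using CUpD(4)[OF F] Pdual_tdual by blast
      then show ?thesis unfolding wstar closure_of_subtopology 1 by auto
    qed
    show ?thesis
    proof (intro equalityI subsetI)
      fix F assume "F \<in> D_plus T P"
      then have "F \<in> CUp" "F = wstar T closure_of fextreme_points F"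
        by (auto simp: D_plus_def D_set_def CU)
      then show "F \<in> Dp" using cl[of F] by (simp add: Dp_def)
    next
      fix F assume "F \<in> Dp"
      then have F: "F \<in> CUp" "F = closure (fextreme_points F)" by (auto simp: Dp_def)
      then have "F \<in> CU_plus T P" "F = wstar T closure_of fextreme_points F" using cl by (auto simp: CU)
      then show "F \<in> D_plus T P" unfolding D_plus_def D_set_def CU_plus_def by blast
    qed
  qed
  then show ?thesis using Dp_dense Dp_gdelta by (simp add: CU CUp_top_def)
qed

end
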